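(* Let $(A,\delta)$ be a cocommutative coassociative coalgebra over $K$ with linear maps $F,G:A\to A$. Define $\Delta_{(F,G)}:A\to A\otimes A$ by $\Delta_{(F,G)}(x)=x_{[1]}\otimes F(x_{[2]})+G(x)_{[1]}\otimes G(x)_{[2]}$ for $x\in A$. Then $(A,\Delta_{(F,G)})$ is a left Alia coalgebra. If moreover $((A,\delta),F)$ is a Nijenhuis coassociative coalgebra (i.e. $F$ is a Nijenhuis operator on $(A,\delta)$) and $F\circ G=G\circ F$, then $((A,\Delta_{(F,G)}),F)$ is a Nijenhuis (special) left Alia coalgebra.
   Context: All vector spaces are over a field $K$ of characteristic zero. Sweedler notation without summation sign: $\delta(x)=x_{[1]}\otimes x_{[2]}$ and $\Delta(x)=x_{(1)}\otimes x_{(2)}$; thus $G(x)_{[1]}\otimes G(x)_{[2]}=\delta(G(x))$. Coalgebras are not required to have a counit. A left Alia coalgebra is a vector space $A$ with a linear map $\Delta:A\to A\otimes A$ such that for all $x\in A$ $$x_{(1)(2)}\otimes x_{(1)(1)}\otimes x_{(2)}+x_{(1)(1)}\otimes x_{(2)}\otimes x_{(1)(2)}+x_{(2)}\otimes x_{(1)(2)}\otimes x_{(1)(1)}=x_{(1)(1)}\otimes x_{(1)(2)}\otimes x_{(2)}+x_{(1)(2)}\otimes x_{(2)}\otimes x_{(1)(1)}+x_{(2)}\otimes x_{(1)(1)}\otimes x_{(1)(2)},$$ where $x_{(1)(1)}\otimes x_{(1)(2)}\otimes x_{(2)}=(\Delta\otimes\mathrm{id})\Delta(x)$. A Nijenhuis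 operator on a vector space $A$ with comultiplication $\Delta$ is a linear map $S:A\to A$ with, for all $x\in A$, $$S(x_{(1)})\otimes S(x_{(2)})+S^2(x)_{(1)}\otimes S^2(x)_{(2)}=S(S(x)_{(1)})\otimes S(x)_{(2)}+S(x)_{(1)}\otimes S(S(x)_{(2)})$$ (and the same formula with $\delta$ in place of $\Delta$ for a coassociative coalgebra). A Nijenhuis left Alia coalgebra is a pair $((A,\Delta),S)$ with $(A,\Delta)$ a left Alia coalgebra and $S$ a Nijenhuis operator on it. "Special" means that the comultiplication has the form $\Delta_{(F,G)}$. *)

theory Defs
  imports "HOL-Algebra.Module" "HOL-Algebra.AbelCoset"
begin

text \<open>
  Vector spaces are modules in the sense of \<^theory>\<open>HOL-Algebra.Module\<close> over a field.
  The \<open>mult\<close> and \<open>one\<close> fields of a module record carry no meaning, and maps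
  between modules matter only on the carriers.
\<close>

section \<open>Linear algebra\<close>

locale field_char_zero = field +
  assumes char_zero: "\<And>n::nat. n > 0 \<Longrightarrow> [n] \<cdot> \<one> \<noteq> \<zero>"

locale char_zero_vector_space = field_char_zero R + module R A for R (structure) and A (structure)

definition linear_maps ::
  "('r, 'm) ring_scheme \<Rightarrow> ('r, 'a, 'n) module_scheme \<Rightarrow> ('r, 'b, 'p) module_scheme \<Rightarrow> ('a \<Rightarrow> 'b) set"
  where "linear_maps R A B =
    {f \<in> hom (add_monoid A) (add_monoid B).
       \<forall>r\<in>carrier R. \<forall>x\<in>carrier A. f (r \<odot>\<^bsub>A\<^esub> x) = r \<odot>\<^bsub>B\<^esub> f x}"

definition free_module :: "('r, 'm) ring_scheme \<Rightarrow> 'x set \<Rightarrow> ('r, 'x \<Rightarrow> 'r) module"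
  where "free_module R X =
    \<lparr>carrier = {f. (\<forall>x\<in>X. f x \<in> carrier R) \<and> (\<forall>x. x \<notin> X \<longrightarrow> f x = \<zero>\<^bsub>R\<^esub>) \<and>
                  finite {x. f x \<noteq> \<zero>\<^bsub>R\<^esub>}},
     mult = undefined, one = undefined,
     zero = (\<lambda>x. \<zero>\<^bsub>R\<^esub>), add = (\<lambda>f g x. f x \<oplus>\<^bsub>R\<^esub> g x),
     smult = (\<lambda>r f x. r \<otimes>\<^bsub>R\<^esub> f x)\<rparr>"

definition free_gen :: "('r, 'm) ring_scheme \<Rightarrow> 'x \<Rightarrow> 'x \<Rightarrow> 'r"
  where "free_gen R x = (\<lambda>y. if y = x then \<one>\<^bsub>R\<^esub> else \<zero>\<^bsub>R\<^esub>)"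

definition submodule_span :: "('r, 'm) ring_scheme \<Rightarrow> ('r, 'a, 'n) module_scheme \<Rightarrow> 'a set \<Rightarrow> 'a set"
  where "submodule_span R M X = \<Inter>{N. submodule N R M \<and> X \<subseteq> N}"

text \<open>The scalar multiple of a coset is closed up under adding \<open>N\<close>, so that multiplying by
  zero gives \<open>N\<close> and not just \<open>{\<zero>}\<close>.\<close>

definition quotient_module :: "('r, 'a, 'n) module_scheme \<Rightarrow> 'a set \<Rightarrow> ('r, 'a set) module"
  where "quotient_module M N =
    \<lparr>carrier = a_rcosets\<^bsub>M\<^esub> N, mult = undefined, one = undefined,
     zero = N, add = set_add M,
     smult = (\<lambda>r C. \<Union>x\<in>C. N +>\<^bsub>M\<^esub> (r \<odot>\<^bsub>M\<^esub> x))\<rparr>"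

section \<open>Tensor products\<close>

definition tensor_relators ::
  "('r, 'm) ring_scheme \<Rightarrow> ('r, 'a, 'n) module_scheme \<Rightarrow> ('r, 'b, 'p) module_scheme \<Rightarrow>
     ('a \<times> 'b \<Rightarrow> 'r) set"
  where "tensor_relators R A B =
    (let Fr = free_module R (carrier A \<times> carrier B); e = (\<lambda>a b. free_gen R (a, b)) in
      {e (a \<oplus>\<^bsub>A\<^esub> a') b \<ominus>\<^bsub>Fr\<^esub> (e a b \<oplus>\<^bsub>Fr\<^esub> e a' b) | a a' b.
         a \<in> carrier A \<and> a' \<in> carrier A \<and> b \<in> carrier B} \<union>
      {e a (b \<oplus>\<^bsub>B\<^esub> b') \<ominus>\<^bsub>Fr\<^esub> (e a b \<oplus>\<^bsub>Fr\<^esub> e a b') | a b b'.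
         a \<in> carrier A \<and> b \<in> carrier B \<and> b' \<in> carrier B} \<union>
      {e (r \<odot>\<^bsub>A\<^esub> a) b \<ominus>\<^bsub>Fr\<^esub> (r \<odot>\<^bsub>Fr\<^esub> e a b) | r a b.
         r \<in> carrier R \<and> a \<in> carrier A \<and> b \<in> carrier B} \<union>
      {e a (r \<odot>\<^bsub>B\<^esub> b) \<ominus>\<^bsub>Fr\<^esub> (r \<odot>\<^bsub>Fr\<^esub> e a b) | r a b.
         r \<in> carrier R \<and> a \<in> carrier A \<and> b \<in> carrier B})"

definition tensor_kernel ::
  "('r, 'm) ring_scheme \<Rightarrow> ('r, 'a, 'n) module_scheme \<Rightarrow> ('r, 'b, 'p) module_scheme \<Rightarrow>
     ('a \<times> 'b \<Rightarrow> 'r) set"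
  where "tensor_kernel R A B =
    submodule_span R (free_module R (carrier A \<times> carrier B)) (tensor_relators R A B)"

definition tensor ::
  "('r, 'm) ring_scheme \<Rightarrow> ('r, 'a, 'n) module_scheme \<Rightarrow> ('r, 'b, 'p) module_scheme \<Rightarrow>
     ('r, ('a \<times> 'b \<Rightarrow> 'r) set) module"
  where "tensor R A B =
    quotient_module (free_module R (carrier A \<times> carrier B)) (tensor_kernel R A B)"

definition pure_tensor ::
  "('r, 'm) ring_scheme \<Rightarrow> ('r, 'a, 'n) module_scheme \<Rightarrow> ('r, 'b, 'p) module_scheme \<Rightarrow>
     'a \<Rightarrow> 'b \<Rightarrow> ('a \<times> 'b \<Rightarrow> 'r) set"
  where "pure_tensor R A B a b =
    tensor_kernel R A B +>\<^bsub>free_module R (carrier A \<times> carrier B)\<^esub> free_gen R (a, b)"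

text \<open>
  For \<open>\<phi>\<close> bilinear on \<open>A \<times> B\<close> with values in \<open>T\<close>, \<open>tensor_lift R A B T \<phi>\<close> is the induced
  linear map from \<open>tensor R A B\<close> to \<open>T\<close>. The sum below takes the same value on every
  representative \<open>f\<close> of the class \<open>t\<close>, so the image of \<open>t\<close> is a singleton. This is what gives
  meaning to Sweedler notation: the expression \<open>\<phi> t\<^bsub>(1)\<^esub> t\<^bsub>(2)\<^esub>\<close> is \<open>tensor_lift R A B T \<phi> t\<close>.
\<close>

definition tensor_lift ::
  "('r, 'm) ring_scheme \<Rightarrow> ('r, 'a, 'n) module_scheme \<Rightarrow> ('r, 'b, 'p) module_scheme \<Rightarrow>
     ('r, 't, 'q) module_scheme \<Rightarrow> ('a \<Rightarrow> 'b \<Rightarrow> 't) \<Rightarrow> ('a \<times> 'b \<Rightarrow> 'r) set \<Rightarrow> 't"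
  where "tensor_lift R A B T \<phi> t =
    the_elem ((\<lambda>f. \<Oplus>\<^bsub>T\<^esub>p\<in>{p. f p \<noteq> \<zero>\<^bsub>R\<^esub>}. f p \<odot>\<^bsub>T\<^esub> \<phi> (fst p) (snd p)) ` t)"

definition tensor_map ::
  "('r, 'm) ring_scheme \<Rightarrow> ('r, 'a, 'n) module_scheme \<Rightarrow> ('r, 'b, 'p) module_scheme \<Rightarrow>
     ('r, 'c, 'q) module_scheme \<Rightarrow> ('r, 'd, 's) module_scheme \<Rightarrow>
     ('a \<Rightarrow> 'c) \<Rightarrow> ('b \<Rightarrow> 'd) \<Rightarrow> ('a \<times> 'b \<Rightarrow> 'r) set \<Rightarrow> ('c \<times> 'd \<Rightarrow> 'r) set"
  where "tensor_map R A B C D f g =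
    tensor_lift R A B (tensor R C D) (\<lambda>a b. pure_tensor R C D (f a) (g b))"

definition tensor_swap ::
  "('r, 'm) ring_scheme \<Rightarrow> ('r, 'a, 'n) module_scheme \<Rightarrow> ('r, 'b, 'p) module_scheme \<Rightarrow>
     ('a \<times> 'b \<Rightarrow> 'r) set \<Rightarrow> ('b \<times> 'a \<Rightarrow> 'r) set"
  where "tensor_swap R A B = tensor_lift R A B (tensor R B A) (\<lambda>a b. pure_tensor R B A b a)"

text \<open>For \<open>\<phi>\<close> trilinear, the induced linear map on the left-bracketed triple tensor product.\<close>

definition tensor_lift3 ::
  "('r, 'm) ring_scheme \<Rightarrow> ('r, 'a, 'n) module_scheme \<Rightarrow> ('r, 'b, 'p) module_scheme \<Rightarrow>
     ('r, 'c, 'q) module_scheme \<Rightarrow> ('r, 't, 's) module_scheme \<Rightarrow> ('a \<Rightarrow> 'b \<Rightarrow> 'c \<Rightarrow> 't) \<Rightarrow>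
     (('a \<times> 'b \<Rightarrow> 'r) set \<times> 'c \<Rightarrow> 'r) set \<Rightarrow> 't"
  where "tensor_lift3 R A B C T \<phi> =
    tensor_lift R (tensor R A B) C T (\<lambda>u c. tensor_lift R A B T (\<lambda>a b. \<phi> a b c) u)"

definition tensor_assoc ::
  "('r, 'm) ring_scheme \<Rightarrow> ('r, 'a, 'n) module_scheme \<Rightarrow> ('r, 'b, 'p) module_scheme \<Rightarrow>
     ('r, 'c, 'q) module_scheme \<Rightarrow>
     (('a \<times> 'b \<Rightarrow> 'r) set \<times> 'c \<Rightarrow> 'r) set \<Rightarrow> ('a \<times> ('b \<times> 'c \<Rightarrow> 'r) set \<Rightarrow> 'r) set"
  where "tensor_assoc R A B C =
    tensor_lift3 R A B C (tensor R A (tensor R B C))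
      (\<lambda>a b c. pure_tensor R A (tensor R B C) a (pure_tensor R B C b c))"

section \<open>Coalgebras\<close>

type_synonym ('r, 'a) comult = "'a \<Rightarrow> ('a \<times> 'a \<Rightarrow> 'r) set"

abbreviation (input) tensor2 ::
  "('r, 'm) ring_scheme \<Rightarrow> ('r, 'a, 'n) module_scheme \<Rightarrow> ('r, ('a \<times> 'a \<Rightarrow> 'r) set) module"
  where "tensor2 R A \<equiv> tensor R A A"

abbreviation (input) tensor3 ::
  "('r, 'm) ring_scheme \<Rightarrow> ('r, 'a, 'n) module_scheme \<Rightarrow>
     ('r, (('a \<times> 'a \<Rightarrow> 'r) set \<times> 'a \<Rightarrow> 'r) set) module"
  where "tensor3 R A \<equiv> tensor R (tensor R A A) A"

definition pure_tensor3 ::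
  "('r, 'm) ring_scheme \<Rightarrow> ('r, 'a, 'n) module_scheme \<Rightarrow> 'a \<Rightarrow> 'a \<Rightarrow> 'a \<Rightarrow>
     (('a \<times> 'a \<Rightarrow> 'r) set \<times> 'a \<Rightarrow> 'r) set"
  where "pure_tensor3 R A a b c = pure_tensor R (tensor2 R A) A (pure_tensor R A A a b) c"

locale comultiplication = char_zero_vector_space R A for R (structure) and A (structure) +
  fixes \<Delta> :: "('r, 'a) comult"
  assumes comult_linear: "\<Delta> \<in> linear_maps R A (tensor2 R A)"

locale coassociative_coalgebra = comultiplication +
  assumes coassociative: "x \<in> carrier A \<Longrightarrow>
    tensor_assoc R A A A (tensor_map R A A (tensor2 R A) A \<Delta> id (\<Delta> x)) =
    tensor_map R A A A (tensor2 R A) id \<Delta> (\<Delta> x)"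

locale cocommutative_coassociative_coalgebra = coassociative_coalgebra +
  assumes cocommutative: "x \<in> carrier A \<Longrightarrow> tensor_swap R A A (\<Delta> x) = \<Delta> x"

text \<open>
  With \<open>t = (\<Delta> \<otimes> id) (\<Delta> x)\<close>, the bound variables \<open>a, b, c\<close> stand for the Sweedler components
  \<open>x\<^bsub>(1)(1)\<^esub>\<close>, \<open>x\<^bsub>(1)(2)\<^esub>\<close>, \<open>x\<^bsub>(2)\<^esub>\<close>.
\<close>

definition sweedler3 ::
  "('r, 'm) ring_scheme \<Rightarrow> ('r, 'a, 'n) module_scheme \<Rightarrow> ('r, 'a) comult \<Rightarrow>
     ('a \<Rightarrow> 'a \<Rightarrow> 'a \<Rightarrow> (('a \<times> 'a \<Rightarrow> 'r) set \<times> 'a \<Rightarrow> 'r) set) \<Rightarrow> 'a \<Rightarrow>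
     (('a \<times> 'a \<Rightarrow> 'r) set \<times> 'a \<Rightarrow> 'r) set"
  where "sweedler3 R A \<Delta> \<phi> x =
    tensor_lift3 R A A A (tensor3 R A) \<phi> (tensor_map R A A (tensor2 R A) A \<Delta> id (\<Delta> x))"

locale left_alia_coalgebra = comultiplication +
  assumes left_alia: "x \<in> carrier A \<Longrightarrow>
    sweedler3 R A \<Delta> (\<lambda>a b c. pure_tensor3 R A b a c) x \<oplus>\<^bsub>tensor3 R A\<^esub>
    sweedler3 R A \<Delta> (\<lambda>a b c. pure_tensor3 R A a c b) x \<oplus>\<^bsub>tensor3 R A\<^esub>
    sweedler3 R A \<Delta> (\<lambda>a b c. pure_tensor3 R A c b a) x =
    tensor_map R A A (tensor2 R A) A \<Delta> id (\<Delta> x) \<oplus>\<^bsub>tensor3 R A\<^esub>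
    sweedler3 R A \<Delta> (\<lambda>a b c. pure_tensor3 R A b c a) x \<oplus>\<^bsub>tensor3 R A\<^esub>
    sweedler3 R A \<Delta> (\<lambda>a b c. pure_tensor3 R A c a b) x"

locale nijenhuis_operator = comultiplication R A \<Delta>
  for R (structure) and A (structure) and \<Delta> :: "('r, 'a) comult" +
  fixes S :: "'a \<Rightarrow> 'a"
  assumes operator_linear: "S \<in> linear_maps R A A"
    and nijenhuis: "x \<in> carrier A \<Longrightarrow>
      tensor_map R A A A A S S (\<Delta> x) \<oplus>\<^bsub>tensor2 R A\<^esub> \<Delta> (S (S x)) =
      tensor_map R A A A A S id (\<Delta> (S x)) \<oplus>\<^bsub>tensor2 R A\<^esub> tensor_map R A A A A id S (\<Delta> (S x))"

locale nijenhuis_coassociative_coalgebra = coassociative_coalgebra + nijenhuis_operator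

locale nijenhuis_left_alia_coalgebra = left_alia_coalgebra + nijenhuis_operator

definition special_comult ::
  "('r, 'm) ring_scheme \<Rightarrow> ('r, 'a, 'n) module_scheme \<Rightarrow> ('r, 'a) comult \<Rightarrow>
     ('a \<Rightarrow> 'a) \<Rightarrow> ('a \<Rightarrow> 'a) \<Rightarrow> ('r, 'a) comult"
  where "special_comult R A \<delta> F G x =
    tensor_map R A A A A id F (\<delta> x) \<oplus>\<^bsub>tensor2 R A\<^esub> \<delta> (G x)"

locale special_left_alia_coalgebra = left_alia_coalgebra +
  assumes special: "\<exists>\<delta> F G. cocommutative_coassociative_coalgebra R A \<delta> \<and>
    F \<in> linear_maps R A A \<and> G \<in> linear_maps R A A \<and>
    (\<forall>x\<in>carrier A. \<Delta> x = special_comult R A \<delta> F G x)"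

locale nijenhuis_special_left_alia_coalgebra =
  special_left_alia_coalgebra + nijenhuis_left_alia_coalgebra

end

theory Submission
  imports Defs
begin

text \<open>
  The left Alia identity for a comultiplication \<open>\<Delta>\<close> says that the antisymmetrization over the
  symmetric group on three letters of \<open>(\<Delta> \<otimes> id) (\<Delta> x)\<close> is zero: the terms on its left are the
  three transpositions of that tensor and those on its right the three even permutations. A
  tensor that is fixed by a transposition antisymmetrizes to zero, because the transposition
  pairs each even permutation with an odd one. For \<open>\<Delta> = \<Delta>\<^bsub>(F,G)\<^esub>\<close> one has
  \<open>(\<Delta> \<otimes> id) (\<Delta> x) = (1 \<otimes> F \<otimes> F) u_x + (\<delta> \<otimes> 1) w + (1 \<otimes> F \<otimes> 1) u_y + (\<delta> \<otimes> 1) w'\<close>,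
  where \<open>y = G x\<close>, \<open>u_x = (\<delta> \<otimes> 1) (\<delta> x)\<close>, \<open>w = (G \<otimes> F) (\<delta> x)\<close> and \<open>w' = (G \<otimes> 1) (\<delta> (G x))\<close>. By
  cocommutativity the second and fourth summands are fixed by swapping the first two factors,
  and together with coassociativity it makes \<open>u_x\<close> invariant under all permutations, so that
  the first summand is fixed by swapping the last two factors and the third by swapping the
  outer two. Hence each of the four summands antisymmetrizes to zero
  (\<open>\<Delta>_iterated_antisymmetrizes_to_zero\<close>).

  The Nijenhuis identity for \<open>\<Delta>\<^bsub>(F,G)\<^esub>\<close> at \<open>x\<close> is the sum of two Nijenhuis identities for
  \<open>\<delta>\<close>: the one at \<open>x\<close> after applying \<open>1 \<otimes> F\<close>, which commutes with \<open>F \<otimes> 1\<close> and \<open>F \<otimes> F\<close>,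
  and the one at \<open>G x\<close>, where \<open>F\<close> can be moved past \<open>G\<close> (\<open>special_nijenhuis\<close>).

  All identities between tensors are proved by comparing linear maps on pure tensors. The first
  half of the theory provides what this needs: tensor products, built as quotients of free
  modules, are modules spanned by pure tensors (\<open>tensor_ext\<close>), and bilinear and trilinear maps
  factor through them (\<open>tensor_lift_linear\<close>, \<open>tensor_lift_pure\<close>, \<open>tensor_lift3_pure\<close>).
\<close>


section \<open>Linear and bilinear maps\<close>

lemma linear_mapsI:
  assumes "\<And>x. x \<in> carrier A \<Longrightarrow> f x \<in> carrier B"
    and "\<And>x y. x \<in> carrier A \<Longrightarrow> y \<in> carrier A \<Longrightarrow> f (x \<oplus>\<^bsub>A\<^esub> y) = f x \<oplus>\<^bsub>B\<^esub> f y"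
    and "\<And>r x. r \<in> carrier R \<Longrightarrow> x \<in> carrier A \<Longrightarrow> f (r \<odot>\<^bsub>A\<^esub> x) = r \<odot>\<^bsub>B\<^esub> f x"
  shows "f \<in> linear_maps R A B"
  using assms by (auto simp: linear_maps_def hom_def)

lemma
  assumes "f \<in> linear_maps R A B"
  shows linear_closed: "x \<in> carrier A \<Longrightarrow> f x \<in> carrier B"
    and linear_add: "x \<in> carrier A \<Longrightarrow> y \<in> carrier A \<Longrightarrow> f (x \<oplus>\<^bsub>A\<^esub> y) = f x \<oplus>\<^bsub>B\<^esub> f y"
    and linear_smult: "r \<in> carrier R \<Longrightarrow> x \<in> carrier A \<Longrightarrow> f (r \<odot>\<^bsub>A\<^esub> x) = r \<odot>\<^bsub>B\<^esub> f x"
  using assms by (auto simp: linear_maps_def hom_def)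

lemma linear_zero:
  assumes "module R A" "module R B" "f \<in> linear_maps R A B"
  shows "f \<zero>\<^bsub>A\<^esub> = \<zero>\<^bsub>B\<^esub>"
proof -
  interpret A: module R A by fact
  interpret B: module R B by fact
  have "f \<zero>\<^bsub>A\<^esub> = f (\<zero>\<^bsub>R\<^esub> \<odot>\<^bsub>A\<^esub> \<zero>\<^bsub>A\<^esub>)" by simp
  also have "\<dots> = \<zero>\<^bsub>R\<^esub> \<odot>\<^bsub>B\<^esub> f \<zero>\<^bsub>A\<^esub>"
    by (rule linear_smult[OF assms(3)]) simp_all
  also have "\<dots> = \<zero>\<^bsub>B\<^esub>"
    using linear_closed[OF assms(3)] by simp
  finally show ?thesis .
qed

lemma linear_minus:
  assumes "module R A" "module R B" "f \<in> linear_maps R A B" "x \<in> carrier A" "y \<in> carrier A"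
  shows "f (x \<ominus>\<^bsub>A\<^esub> y) = f x \<ominus>\<^bsub>B\<^esub> f y"
proof -
  interpret A: module R A by fact
  interpret B: module R B by fact
  have "f (x \<ominus>\<^bsub>A\<^esub> y) = f (x \<oplus>\<^bsub>A\<^esub> (\<ominus>\<^bsub>R\<^esub> \<one>\<^bsub>R\<^esub>) \<odot>\<^bsub>A\<^esub> y)"
    using assms(4,5) by (simp add: A.smult_l_minus A.minus_eq)
  also have "\<dots> = f x \<ominus>\<^bsub>B\<^esub> f y"
    using assms(4,5) linear_closed[OF assms(3)]
    by (simp add: linear_add[OF assms(3)] linear_smult[OF assms(3)] B.smult_l_minus B.minus_eq)
  finally show ?thesis .
qed

lemma linear_id: "id \<in> linear_maps R A A"
  by (rule linear_mapsI) auto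

lemma linear_comp:
  assumes "f \<in> linear_maps R A B" "g \<in> linear_maps R B C"
  shows "(\<lambda>x. g (f x)) \<in> linear_maps R A C"
  by (rule linear_mapsI)
     (simp_all add: linear_closed[OF assms(1)] linear_closed[OF assms(2)]
        linear_add[OF assms(1)] linear_add[OF assms(2)]
        linear_smult[OF assms(1)] linear_smult[OF assms(2)])

lemma linear_sum:
  assumes "module R B" "f \<in> linear_maps R A B" "g \<in> linear_maps R A B"
  shows "(\<lambda>x. f x \<oplus>\<^bsub>B\<^esub> g x) \<in> linear_maps R A B"
proof -
  interpret B: module R B by fact
  show ?thesis
    by (rule linear_mapsI)
       (simp_all add: linear_closed[OF assms(2)] linear_closed[OF assms(3)]
          linear_add[OF assms(2)] linear_add[OF assms(3)]
          linear_smult[OF assms(2)] linear_smult[OF assms(3)] B.smult_r_distr B.a_ac)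
qed

lemma linear_scaled:
  assumes "module R B" "r \<in> carrier R" "f \<in> linear_maps R A B"
  shows "(\<lambda>x. r \<odot>\<^bsub>B\<^esub> f x) \<in> linear_maps R A B"
proof -
  interpret B: module R B by fact
  show ?thesis
    using assms(2)
    by (intro linear_mapsI)
       (simp_all add: linear_closed[OF assms(3)] linear_add[OF assms(3)]
          linear_smult[OF assms(3)] B.smult_r_distr B.smult_assoc1[symmetric] B.m_comm)
qed

text \<open>The conditions concern arguments from the carriers only, since a map between modules is
  meaningless elsewhere.\<close>

definition bilinear_map ::
  "('r, 'm) ring_scheme \<Rightarrow> ('r, 'a, 'n) module_scheme \<Rightarrow> ('r, 'b, 'p) module_scheme \<Rightarrow>
     ('r, 't, 'q) module_scheme \<Rightarrow> ('a \<Rightarrow> 'b \<Rightarrow> 't) \<Rightarrow> bool"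
  where "bilinear_map R A B T \<phi> \<longleftrightarrow>
    (\<forall>b\<in>carrier B. (\<lambda>a. \<phi> a b) \<in> linear_maps R A T) \<and>
    (\<forall>a\<in>carrier A. \<phi> a \<in> linear_maps R B T)"

lemma bilinear_mapI:
  assumes "\<And>b. b \<in> carrier B \<Longrightarrow> (\<lambda>a. \<phi> a b) \<in> linear_maps R A T"
    and "\<And>a. a \<in> carrier A \<Longrightarrow> \<phi> a \<in> linear_maps R B T"
  shows "bilinear_map R A B T \<phi>"
  using assms by (simp add: bilinear_map_def)

lemma
  assumes "bilinear_map R A B T \<phi>"
  shows bilinear_left: "b \<in> carrier B \<Longrightarrow> (\<lambda>a. \<phi> a b) \<in> linear_maps R A T"
    and bilinear_right: "a \<in> carrier A \<Longrightarrow> \<phi> a \<in> linear_maps R B T"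
  using assms by (simp_all add: bilinear_map_def)

lemma bilinear_closed:
  assumes "bilinear_map R A B T \<phi>" "a \<in> carrier A" "b \<in> carrier B"
  shows "\<phi> a b \<in> carrier T"
  by (rule linear_closed[OF bilinear_right[OF assms(1,2)] assms(3)])

lemma bilinear_flip:
  "bilinear_map R A B T \<phi> \<Longrightarrow> bilinear_map R B A T (\<lambda>b a. \<phi> a b)"
  by (simp add: bilinear_map_def)

lemma bilinear_precomp:
  assumes "bilinear_map R C D T \<phi>" "f \<in> linear_maps R A C" "g \<in> linear_maps R B D"
  shows "bilinear_map R A B T (\<lambda>a b. \<phi> (f a) (g b))"
proof (rule bilinear_mapI)
  fix b assume "b \<in> carrier B"
  then show "(\<lambda>a. \<phi> (f a) (g b)) \<in> linear_maps R A T"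
    using linear_comp[OF assms(2) bilinear_left[OF assms(1)]] linear_closed[OF assms(3)] by blast
next
  fix a assume "a \<in> carrier A"
  then show "(\<lambda>b. \<phi> (f a) (g b)) \<in> linear_maps R B T"
    using linear_comp[OF assms(3) bilinear_right[OF assms(1)]] linear_closed[OF assms(2)] by blast
qed

section \<open>Free modules\<close>

lemma in_free_module:
  "f \<in> carrier (free_module R X) \<longleftrightarrow>
     (\<forall>x\<in>X. f x \<in> carrier R) \<and> (\<forall>x. x \<notin> X \<longrightarrow> f x = \<zero>\<^bsub>R\<^esub>) \<and> finite {x. f x \<noteq> \<zero>\<^bsub>R\<^esub>}"
  by (simp add: free_module_def)

lemma free_module_zero: "\<zero>\<^bsub>free_module R X\<^esub> = (\<lambda>x. \<zero>\<^bsub>R\<^esub>)"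
  and free_module_add: "f \<oplus>\<^bsub>free_module R X\<^esub> g = (\<lambda>x. f x \<oplus>\<^bsub>R\<^esub> g x)"
  and free_module_smult: "r \<odot>\<^bsub>free_module R X\<^esub> f = (\<lambda>x. r \<otimes>\<^bsub>R\<^esub> f x)"
  by (simp_all add: free_module_def)

lemma free_module_coeff:
  assumes "cring R" "f \<in> carrier (free_module R X)"
  shows "f x \<in> carrier R"
proof -
  interpret cring R by fact
  show ?thesis using assms(2) by (cases "x \<in> X") (auto simp: in_free_module)
qed

lemma free_module_module:
  assumes "cring R"
  shows "module R (free_module R X)"
proof -
  interpret cring R by fact
  note coeff = free_module_coeff[OF assms, where X = X]
  show ?thesis
  proof (rule moduleI[OF assms abelian_groupI])
    fix f g assume f: "f \<in> carrier (free_module R X)" and g: "g \<in> carrier (free_module R X)"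
    have "{x. f x \<oplus>\<^bsub>R\<^esub> g x \<noteq> \<zero>\<^bsub>R\<^esub>} \<subseteq> {x. f x \<noteq> \<zero>\<^bsub>R\<^esub>} \<union> {x. g x \<noteq> \<zero>\<^bsub>R\<^esub>}"
      by auto
    then have "finite {x. f x \<oplus>\<^bsub>R\<^esub> g x \<noteq> \<zero>\<^bsub>R\<^esub>}"
      using f g by (auto simp: in_free_module intro: finite_subset)
    then show "f \<oplus>\<^bsub>free_module R X\<^esub> g \<in> carrier (free_module R X)"
      using f g by (auto simp: in_free_module free_module_add)
    show "f \<oplus>\<^bsub>free_module R X\<^esub> g = g \<oplus>\<^bsub>free_module R X\<^esub> f"
      using coeff[OF f] coeff[OF g] by (simp add: free_module_add a_comm)
  next
    fix f assume f: "f \<in> carrier (free_module R X)"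
    have "{x. \<ominus>\<^bsub>R\<^esub> f x \<noteq> \<zero>\<^bsub>R\<^esub>} \<subseteq> {x. f x \<noteq> \<zero>\<^bsub>R\<^esub>}" by auto
    then have "finite {x. \<ominus>\<^bsub>R\<^esub> f x \<noteq> \<zero>\<^bsub>R\<^esub>}"
      using f by (auto simp: in_free_module intro: finite_subset)
    then have "(\<lambda>x. \<ominus>\<^bsub>R\<^esub> f x) \<in> carrier (free_module R X)"
      using f by (auto simp: in_free_module)
    then show "\<exists>g\<in>carrier (free_module R X). g \<oplus>\<^bsub>free_module R X\<^esub> f = \<zero>\<^bsub>free_module R X\<^esub>"
      using coeff[OF f] by (intro bexI[of _ "\<lambda>x. \<ominus>\<^bsub>R\<^esub> f x"])
        (simp_all add: free_module_add free_module_zero l_neg)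
  next
    fix r f assume r: "r \<in> carrier R" and f: "f \<in> carrier (free_module R X)"
    have "{x. r \<otimes>\<^bsub>R\<^esub> f x \<noteq> \<zero>\<^bsub>R\<^esub>} \<subseteq> {x. f x \<noteq> \<zero>\<^bsub>R\<^esub>}" using r by auto
    then have "finite {x. r \<otimes>\<^bsub>R\<^esub> f x \<noteq> \<zero>\<^bsub>R\<^esub>}"
      using f by (auto simp: in_free_module intro: finite_subset)
    then show "r \<odot>\<^bsub>free_module R X\<^esub> f \<in> carrier (free_module R X)"
      using r f by (auto simp: in_free_module free_module_smult)
  qed (simp_all add: free_module_add free_module_zero free_module_smult coeff
        a_assoc l_distr r_distr m_assoc, simp_all add: in_free_module)
qed

lemma free_gen_closed:
  assumes "cring R" "x \<in> X"
  shows "free_gen R x \<in> carrier (free_module R X)"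
proof -
  interpret cring R by fact
  have "{y. free_gen R x y \<noteq> \<zero>\<^bsub>R\<^esub>} \<subseteq> {x}" by (auto simp: free_gen_def)
  then have "finite {y. free_gen R x y \<noteq> \<zero>\<^bsub>R\<^esub>}" by (rule finite_subset) simp
  then show ?thesis using assms(2) by (auto simp: in_free_module free_gen_def)
qed

text \<open>A linear map on a free module is determined by its values on the generators: any element is
  a finite combination of them, and induction on a finite set containing the support peels off
  one generator at a time.\<close>

lemma free_module_ext:
  assumes "cring R" "module R M"
    and h: "h \<in> linear_maps R (free_module R X) M" and k: "k \<in> linear_maps R (free_module R X) M"
    and eq: "\<And>x. x \<in> X \<Longrightarrow> h (free_gen R x) = k (free_gen R x)"
    and f: "f \<in> carrier (free_module R X)"
  shows "h f = k f"
proof -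
  interpret cring R by fact
  interpret Fr: module R "free_module R X" using free_module_module[OF assms(1)] .
  have "\<forall>f\<in>carrier (free_module R X). {x. f x \<noteq> \<zero>\<^bsub>R\<^esub>} \<subseteq> S \<longrightarrow> h f = k f" if "finite S" for S
    using that
  proof induction
    case empty
    show ?case
    proof (intro ballI impI)
      fix f assume "f \<in> carrier (free_module R X)" "{x. f x \<noteq> \<zero>\<^bsub>R\<^esub>} \<subseteq> {}"
      then have "f = \<zero>\<^bsub>free_module R X\<^esub>" by (auto simp: free_module_zero)
      then show "h f = k f"
        using linear_zero[OF Fr.module_axioms assms(2) h] linear_zero[OF Fr.module_axioms assms(2) k] by simp
    qed
  next
    case (insert p S)
    show ?case
    proof (intro ballI impI)
      fix f assume f: "f \<in> carrier (free_module R X)" and supp: "{x. f x \<noteq> \<zero>\<^bsub>R\<^esub>} \<subseteq> insert p S"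
      show "h f = k f"
      proof (cases "f p = \<zero>\<^bsub>R\<^esub>")
        case True
        then have "{x. f x \<noteq> \<zero>\<^bsub>R\<^esub>} \<subseteq> S" using supp by auto
        then show ?thesis using insert.IH f by blast
      next
        case False
        then have p: "p \<in> X" using f by (auto simp: in_free_module)
        define f' where "f' = f(p := \<zero>\<^bsub>R\<^esub>)"
        have fp: "f p \<in> carrier R" using free_module_coeff[OF assms(1) f] .
        have "{x. f' x \<noteq> \<zero>\<^bsub>R\<^esub>} \<subseteq> {x. f x \<noteq> \<zero>\<^bsub>R\<^esub>}" by (auto simp: f'_def)
        then have "finite {x. f' x \<noteq> \<zero>\<^bsub>R\<^esub>}"
          using f by (auto simp: in_free_module intro: finite_subset)
        then have f': "f' \<in> carrier (free_module R X)"
          using f by (auto simp: in_free_module f'_def)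
        have "{x. f' x \<noteq> \<zero>\<^bsub>R\<^esub>} \<subseteq> S" using supp by (auto simp: f'_def)
        then have IH: "h f' = k f'" using insert.IH f' by blast
        have split: "f = f' \<oplus>\<^bsub>free_module R X\<^esub> f p \<odot>\<^bsub>free_module R X\<^esub> free_gen R p"
          using free_module_coeff[OF assms(1) f] fp
          by (auto simp: fun_eq_iff free_module_add free_module_smult f'_def free_gen_def)
        have gen: "free_gen R p \<in> carrier (free_module R X)"
          using free_gen_closed[OF assms(1) p] .
        have "h f = h f' \<oplus>\<^bsub>M\<^esub> f p \<odot>\<^bsub>M\<^esub> h (free_gen R p)"
          by (subst split) (simp add: linear_add[OF h] linear_smult[OF h] f' gen fp)
        moreover have "k f = k f' \<oplus>\<^bsub>M\<^esub> f p \<odot>\<^bsub>M\<^esub> k (free_gen R p)"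
          by (subst split) (simp add: linear_add[OF k] linear_smult[OF k] f' gen fp)
        ultimately show ?thesis using IH eq[OF p] by simp
      qed
    qed
  qed
  then show ?thesis using f by (auto simp: in_free_module)
qed

definition linear_extension ::
  "('r, 'm) ring_scheme \<Rightarrow> ('r, 't, 'q) module_scheme \<Rightarrow> ('x \<Rightarrow> 't) \<Rightarrow> ('x \<Rightarrow> 'r) \<Rightarrow> 't"
  where "linear_extension R T g f = (\<Oplus>\<^bsub>T\<^esub>p\<in>{p. f p \<noteq> \<zero>\<^bsub>R\<^esub>}. f p \<odot>\<^bsub>T\<^esub> g p)"

text \<open>The sum defining \<open>linear_extension\<close> ranges over the support of \<open>f\<close>, which changes under
  addition. Enlarging the index set to a common superset of the supports is what makes
  linearity provable term by term.\<close>

lemma linear_extension_superset: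
  assumes "module R T" "\<And>x. x \<in> X \<Longrightarrow> g x \<in> carrier T"
    and f: "f \<in> carrier (free_module R X)"
    and S: "finite S" "{p. f p \<noteq> \<zero>\<^bsub>R\<^esub>} \<subseteq> S" "S \<subseteq> X"
  shows "linear_extension R T g f = (\<Oplus>\<^bsub>T\<^esub>p\<in>S. f p \<odot>\<^bsub>T\<^esub> g p)"
proof -
  interpret T: module R T by fact
  show ?thesis
    unfolding linear_extension_def
    using f assms(2) S
    by (intro T.add.finprod_mono_neutral_cong_left)
       (auto simp: in_free_module intro!: T.smult_closed)
qed

lemma linear_extension_linear:
  assumes "module R T" and g: "\<And>x. x \<in> X \<Longrightarrow> g x \<in> carrier T"
  shows "linear_extension R T g \<in> linear_maps R (free_module R X) T"
proof -
  interpret T: module R T by fact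
  interpret Fr: module R "free_module R X" using free_module_module[OF T.R.is_cring] .
  note sup = linear_extension_superset[OF assms(1) g, where X = X]
  note coeff = free_module_coeff[OF T.R.is_cring]
  have supp: "finite {p. f p \<noteq> \<zero>\<^bsub>R\<^esub>}" "{p. f p \<noteq> \<zero>\<^bsub>R\<^esub>} \<subseteq> X"
    if "f \<in> carrier (free_module R X)" for f
    using that by (auto simp: in_free_module)
  show ?thesis
  proof (rule linear_mapsI)
    fix f assume f: "f \<in> carrier (free_module R X)"
    show "linear_extension R T g f \<in> carrier T"
      unfolding linear_extension_def
      using g coeff[OF f] supp(2)[OF f] by (intro T.finsum_closed) auto
  next
    fix f f' assume f: "f \<in> carrier (free_module R X)" and f': "f' \<in> carrier (free_module R X)"
    let ?S = "{p. f p \<noteq> \<zero>\<^bsub>R\<^esub>} \<union> {p. f' p \<noteq> \<zero>\<^bsub>R\<^esub>}"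
    have S: "finite ?S" "?S \<subseteq> X" using supp f f' by auto
    have c: "f \<oplus>\<^bsub>free_module R X\<^esub> f' \<in> carrier (free_module R X)" using f f' by simp
    have "linear_extension R T g (f \<oplus>\<^bsub>free_module R X\<^esub> f')
        = (\<Oplus>\<^bsub>T\<^esub>p\<in>?S. (f \<oplus>\<^bsub>free_module R X\<^esub> f') p \<odot>\<^bsub>T\<^esub> g p)"
      by (rule sup[OF _ c S(1) _ S(2)]) (auto simp: free_module_add)
    also have "\<dots> = (\<Oplus>\<^bsub>T\<^esub>p\<in>?S. f p \<odot>\<^bsub>T\<^esub> g p \<oplus>\<^bsub>T\<^esub> f' p \<odot>\<^bsub>T\<^esub> g p)"
      using S(2) coeff[OF f] coeff[OF f'] g
      by (intro T.finsum_cong') (auto simp: free_module_add T.smult_l_distr subset_iff)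
    also have "\<dots> = (\<Oplus>\<^bsub>T\<^esub>p\<in>?S. f p \<odot>\<^bsub>T\<^esub> g p) \<oplus>\<^bsub>T\<^esub> (\<Oplus>\<^bsub>T\<^esub>p\<in>?S. f' p \<odot>\<^bsub>T\<^esub> g p)"
      using S(2) coeff[OF f] coeff[OF f'] g
      by (intro T.finsum_addf) (auto simp: subset_iff)
    also have "(\<Oplus>\<^bsub>T\<^esub>p\<in>?S. f p \<odot>\<^bsub>T\<^esub> g p) = linear_extension R T g f"
      by (rule sup[OF _ f S(1) _ S(2), symmetric]) auto
    also have "(\<Oplus>\<^bsub>T\<^esub>p\<in>?S. f' p \<odot>\<^bsub>T\<^esub> g p) = linear_extension R T g f'"
      by (rule sup[OF _ f' S(1) _ S(2), symmetric]) auto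
    finally show "linear_extension R T g (f \<oplus>\<^bsub>free_module R X\<^esub> f')
      = linear_extension R T g f \<oplus>\<^bsub>T\<^esub> linear_extension R T g f'" .
  next
    fix r f assume r: "r \<in> carrier R" and f: "f \<in> carrier (free_module R X)"
    let ?S = "{p. f p \<noteq> \<zero>\<^bsub>R\<^esub>}"
    have c: "r \<odot>\<^bsub>free_module R X\<^esub> f \<in> carrier (free_module R X)" using r f by simp
    have "linear_extension R T g (r \<odot>\<^bsub>free_module R X\<^esub> f)
        = (\<Oplus>\<^bsub>T\<^esub>p\<in>?S. (r \<odot>\<^bsub>free_module R X\<^esub> f) p \<odot>\<^bsub>T\<^esub> g p)"
      by (rule sup[OF _ c supp(1)[OF f] _ supp(2)[OF f]]) (auto simp: free_module_smult r)
    also have "\<dots> = (\<Oplus>\<^bsub>T\<^esub>p\<in>?S. r \<odot>\<^bsub>T\<^esub> (f p \<odot>\<^bsub>T\<^esub> g p))"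
      using supp(2)[OF f] coeff[OF f] r g
      by (intro T.finsum_cong') (auto simp: free_module_smult T.smult_assoc1 subset_iff)
    also have "\<dots> = r \<odot>\<^bsub>T\<^esub> linear_extension R T g f"
      unfolding linear_extension_def
      using supp[OF f] coeff[OF f] r g
      by (intro T.finsum_smult_ldistr[symmetric]) (auto simp: subset_iff)
    finally show "linear_extension R T g (r \<odot>\<^bsub>free_module R X\<^esub> f)
      = r \<odot>\<^bsub>T\<^esub> linear_extension R T g f" .
  qed
qed

lemma linear_extension_gen:
  assumes "module R T" "\<And>x. x \<in> X \<Longrightarrow> g x \<in> carrier T" "x \<in> X"
  shows "linear_extension R T g (free_gen R x) = g x"
proof -
  interpret T: module R T by fact
  have "linear_extension R T g (free_gen R x) = (\<Oplus>\<^bsub>T\<^esub>p\<in>{x}. free_gen R x p \<odot>\<^bsub>T\<^esub> g p)"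
    by (rule linear_extension_superset[OF assms(1,2) free_gen_closed[OF T.R.is_cring assms(3)]])
       (use assms(3) in \<open>auto simp: free_gen_def\<close>)
  also have "\<dots> = g x"
    using assms(2)[OF assms(3)] by (simp add: free_gen_def)
  finally show ?thesis .
qed

section \<open>Quotient modules\<close>

lemma submodule_span_submodule:
  assumes "module R M" "X \<subseteq> carrier M"
  shows "submodule (submodule_span R M X) R M"
proof -
  interpret M: module R M by fact
  show ?thesis
    unfolding submodule_span_def
    using M.carrier_is_submodule assms(2)
    by (intro M.submoduleI)
       (auto simp: M.submoduleE subset_iff submodule_def subgroup.one_closed
          dest: M.submoduleE(1) subgroup.one_closed)
qed

lemma submodule_span_superset: "X \<subseteq> submodule_span R M X"
  by (auto simp: submodule_span_def)

lemma submodule_span_least: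
  "submodule N R M \<Longrightarrow> X \<subseteq> N \<Longrightarrow> submodule_span R M X \<subseteq> N"
  by (auto simp: submodule_span_def)

lemma kernel_submodule:
  assumes "module R A" "module R B" and f: "f \<in> linear_maps R A B"
  shows "submodule {x \<in> carrier A. f x = \<zero>\<^bsub>B\<^esub>} R A"
proof -
  interpret A: module R A by fact
  interpret B: module R B by fact
  have zero: "f \<zero>\<^bsub>A\<^esub> = \<zero>\<^bsub>B\<^esub>" using linear_zero[OF assms] .
  have "f (\<ominus>\<^bsub>A\<^esub> x) = \<ominus>\<^bsub>B\<^esub> f x" if "x \<in> carrier A" for x
    using linear_minus[OF assms A.zero_closed that] that linear_closed[OF f that]
    by (simp add: A.minus_eq B.minus_eq zero)
  then show ?thesis
    by (intro A.submoduleI) (auto simp: zero linear_add[OF f] linear_smult[OF f])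
qed

locale quotient = module R M + submodule N R M for R (structure) and M (structure) and N
begin

sublocale N: abelian_subgroup N M
  using subgroup_axioms M.abelian_group_axioms
  by (intro abelian_subgroupI3 additive_subgroupI)

lemma quotient_closed: "x \<in> carrier M \<Longrightarrow> N +>\<^bsub>M\<^esub> x \<in> carrier (quotient_module M N)"
  by (auto simp: quotient_module_def A_RCOSETS_def')

lemma quotient_cases:
  assumes "C \<in> carrier (quotient_module M N)"
  obtains x where "x \<in> carrier M" "C = N +>\<^bsub>M\<^esub> x"
  using assms by (auto simp: quotient_module_def A_RCOSETS_def')

lemma quotient_add:
  "x \<in> carrier M \<Longrightarrow> y \<in> carrier M \<Longrightarrow>
    (N +>\<^bsub>M\<^esub> x) \<oplus>\<^bsub>quotient_module M N\<^esub> (N +>\<^bsub>M\<^esub> y) = N +>\<^bsub>M\<^esub> (x \<oplus>\<^bsub>M\<^esub> y)"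
  by (simp add: quotient_module_def N.a_rcos_sum)

lemma quotient_zero: "\<zero>\<^bsub>quotient_module M N\<^esub> = N +>\<^bsub>M\<^esub> \<zero>\<^bsub>M\<^esub>"
  using N.a_subset by (simp add: quotient_module_def)

lemma coset_eqI:
  assumes "x \<in> carrier M" "y \<in> carrier M" "x \<ominus>\<^bsub>M\<^esub> y \<in> N"
  shows "N +>\<^bsub>M\<^esub> x = N +>\<^bsub>M\<^esub> y"
proof -
  have "(x \<ominus>\<^bsub>M\<^esub> y) \<oplus>\<^bsub>M\<^esub> y \<in> N +>\<^bsub>M\<^esub> y"
    using assms N.a_subset by (intro M.a_rcosI) auto
  then have "x \<in> N +>\<^bsub>M\<^esub> y"
    using assms by (simp add: M.minus_eq M.a_assoc M.l_neg)
  then show ?thesis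
    using M.a_repr_independence[OF _ assms(2) N.a_subgroup] by simp
qed

text \<open>Scalar multiplication of cosets is a union over all representatives; since \<open>N\<close> is stable under
  scalars, every representative contributes the same coset.\<close>

lemma quotient_smult:
  assumes "r \<in> carrier R" "x \<in> carrier M"
  shows "r \<odot>\<^bsub>quotient_module M N\<^esub> (N +>\<^bsub>M\<^esub> x) = N +>\<^bsub>M\<^esub> (r \<odot>\<^bsub>M\<^esub> x)"
proof -
  have "N +>\<^bsub>M\<^esub> (r \<odot>\<^bsub>M\<^esub> y) = N +>\<^bsub>M\<^esub> (r \<odot>\<^bsub>M\<^esub> x)" if y: "y \<in> N +>\<^bsub>M\<^esub> x" for y
  proof -
    obtain n where n: "n \<in> N" "y = n \<oplus>\<^bsub>M\<^esub> x"
      using y by (auto simp: a_r_coset_def')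
    then have nc: "n \<in> carrier M" using N.a_subset by auto
    have "r \<odot>\<^bsub>M\<^esub> y \<ominus>\<^bsub>M\<^esub> r \<odot>\<^bsub>M\<^esub> x = r \<odot>\<^bsub>M\<^esub> n"
      using n nc assms by (simp add: smult_r_distr M.minus_eq M.a_assoc M.r_neg)
    then show ?thesis
      using n nc assms by (intro coset_eqI) simp_all
  qed
  moreover have "x \<in> N +>\<^bsub>M\<^esub> x"
    using assms(2) N.a_rcos_self by simp
  ultimately have "(\<Union>y\<in>N +>\<^bsub>M\<^esub> x. N +>\<^bsub>M\<^esub> (r \<odot>\<^bsub>M\<^esub> y)) = N +>\<^bsub>M\<^esub> (r \<odot>\<^bsub>M\<^esub> x)"
    by blast
  then show ?thesis
    by (simp add: quotient_module_def)
qed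

lemma quotient_module_module: "module R (quotient_module M N)"
proof (rule moduleI[OF R.is_cring abelian_groupI])
  fix C assume "C \<in> carrier (quotient_module M N)"
  then obtain x where x: "x \<in> carrier M" "C = N +>\<^bsub>M\<^esub> x"
    by (rule quotient_cases)
  have "(N +>\<^bsub>M\<^esub> \<ominus>\<^bsub>M\<^esub> x) \<oplus>\<^bsub>quotient_module M N\<^esub> C = \<zero>\<^bsub>quotient_module M N\<^esub>"
    using x by (simp add: quotient_add quotient_zero M.l_neg)
  then show "\<exists>D\<in>carrier (quotient_module M N).
      D \<oplus>\<^bsub>quotient_module M N\<^esub> C = \<zero>\<^bsub>quotient_module M N\<^esub>"
    using x(1) by (intro bexI[of _ "N +>\<^bsub>M\<^esub> \<ominus>\<^bsub>M\<^esub> x"] quotient_closed) simp_all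
qed (auto elim!: quotient_cases simp: quotient_closed quotient_add quotient_zero quotient_smult
      M.a_ac smult_l_distr smult_r_distr smult_assoc1)

lemma quotient_map_linear: "(\<lambda>x. N +>\<^bsub>M\<^esub> x) \<in> linear_maps R M (quotient_module M N)"
  by (rule linear_mapsI) (simp_all add: quotient_closed quotient_add quotient_smult)

text \<open>A linear map that vanishes on \<open>N\<close> has a singleton as its image of each coset. This is what
  makes a value extracted with \<open>the_elem\<close> well defined.\<close>

lemma linear_constant_on_coset:
  assumes "module R T" and f: "f \<in> linear_maps R M T"
    and N: "\<And>n. n \<in> N \<Longrightarrow> f n = \<zero>\<^bsub>T\<^esub>" and x: "x \<in> carrier M"
  shows "f ` (N +>\<^bsub>M\<^esub> x) = {f x}"
proof -
  interpret T: module R T by fact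
  have "f y = f x" if y: "y \<in> N +>\<^bsub>M\<^esub> x" for y
  proof -
    obtain n where n: "n \<in> N" "y = n \<oplus>\<^bsub>M\<^esub> x"
      using y by (auto simp: a_r_coset_def')
    moreover have "n \<in> carrier M" using n N.a_subset by auto
    ultimately show ?thesis
      using x N[of n] by (simp add: linear_add[OF f] linear_closed[OF f])
  qed
  moreover have "x \<in> N +>\<^bsub>M\<^esub> x"
    using x N.a_rcos_self by simp
  ultimately show ?thesis by blast
qed

end

section \<open>The universal property of the tensor product\<close>

lemma tensor_relators_closed:
  assumes "module R A" "module R B"
  shows "tensor_relators R A B \<subseteq> carrier (free_module R (carrier A \<times> carrier B))"
proof -
  interpret A: module R A by fact
  interpret B: module R B by fact
  interpret Fr: module R "free_module R (carrier A \<times> carrier B)"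
    using free_module_module[OF A.R.is_cring] .
  have "free_gen R (a, b) \<in> carrier (free_module R (carrier A \<times> carrier B))"
    if "a \<in> carrier A" "b \<in> carrier B" for a b
    using that by (intro free_gen_closed A.R.is_cring) simp
  then show ?thesis
    by (auto simp: tensor_relators_def Let_def)
qed

lemma tensor_quotient:
  assumes "module R A" "module R B"
  shows "quotient R (free_module R (carrier A \<times> carrier B)) (tensor_kernel R A B)"
proof -
  interpret A: module R A by fact
  interpret Fr: module R "free_module R (carrier A \<times> carrier B)"
    using free_module_module[OF A.R.is_cring] .
  show ?thesis
    unfolding tensor_kernel_def
    using Fr.module_axioms
    by (intro quotient.intro submodule_span_submodule tensor_relators_closed assms)
qed

lemma tensor_module:
  assumes "module R A" "module R B"
  shows "module R (tensor R A B)"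
  unfolding tensor_def by (rule quotient.quotient_module_module[OF tensor_quotient[OF assms]])

text \<open>Each clause of bilinearity is one of the four families of relators, read modulo the
  submodule that they span.\<close>

lemma pure_tensor_bilinear:
  assumes "module R A" "module R B"
  shows "bilinear_map R A B (tensor R A B) (pure_tensor R A B)"
proof -
  interpret A: module R A by fact
  interpret B: module R B by fact
  interpret quotient R "free_module R (carrier A \<times> carrier B)" "tensor_kernel R A B"
    using tensor_quotient[OF assms] .
  let ?e = "\<lambda>a b. free_gen R (a, b)" and ?Fr = "free_module R (carrier A \<times> carrier B)"
  have gen: "?e a b \<in> carrier ?Fr" if "a \<in> carrier A" "b \<in> carrier B" for a b
    using that by (intro free_gen_closed A.R.is_cring) simp
  have rel: "x \<in> tensor_relators R A B \<Longrightarrow> x \<in> tensor_kernel R A B" for x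
    unfolding tensor_kernel_def by (rule subsetD[OF submodule_span_superset])
  note defs = tensor_def pure_tensor_def
  have closed: "pure_tensor R A B a b \<in> carrier (tensor R A B)"
    if "a \<in> carrier A" "b \<in> carrier B" for a b
    unfolding defs using gen[OF that] by (rule quotient_closed)
  show ?thesis
  proof (intro bilinear_mapI linear_mapsI closed)
    fix a a' b assume c: "a \<in> carrier A" "a' \<in> carrier A" "b \<in> carrier B"
    have "?e (a \<oplus>\<^bsub>A\<^esub> a') b \<ominus>\<^bsub>?Fr\<^esub> (?e a b \<oplus>\<^bsub>?Fr\<^esub> ?e a' b) \<in> tensor_kernel R A B"
      using c by (intro rel) (unfold tensor_relators_def Let_def, blast)
    then show "pure_tensor R A B (a \<oplus>\<^bsub>A\<^esub> a') b
        = pure_tensor R A B a b \<oplus>\<^bsub>tensor R A B\<^esub> pure_tensor R A B a' b"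
      using c gen by (simp add: defs quotient_add) (rule coset_eqI; simp)
  next
    fix a b b' assume c: "a \<in> carrier A" "b \<in> carrier B" "b' \<in> carrier B"
    have "?e a (b \<oplus>\<^bsub>B\<^esub> b') \<ominus>\<^bsub>?Fr\<^esub> (?e a b \<oplus>\<^bsub>?Fr\<^esub> ?e a b') \<in> tensor_kernel R A B"
      using c by (intro rel) (unfold tensor_relators_def Let_def, blast)
    then show "pure_tensor R A B a (b \<oplus>\<^bsub>B\<^esub> b')
        = pure_tensor R A B a b \<oplus>\<^bsub>tensor R A B\<^esub> pure_tensor R A B a b'"
      using c gen by (simp add: defs quotient_add) (rule coset_eqI; simp)
  next
    fix r a b assume c: "r \<in> carrier R" "a \<in> carrier A" "b \<in> carrier B"
    have "?e (r \<odot>\<^bsub>A\<^esub> a) b \<ominus>\<^bsub>?Fr\<^esub> (r \<odot>\<^bsub>?Fr\<^esub> ?e a b) \<in> tensor_kernel R A B"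
      using c by (intro rel) (unfold tensor_relators_def Let_def, blast)
    then show "pure_tensor R A B (r \<odot>\<^bsub>A\<^esub> a) b = r \<odot>\<^bsub>tensor R A B\<^esub> pure_tensor R A B a b"
      using c gen by (simp add: defs quotient_smult) (rule coset_eqI; simp)
    have "?e a (r \<odot>\<^bsub>B\<^esub> b) \<ominus>\<^bsub>?Fr\<^esub> (r \<odot>\<^bsub>?Fr\<^esub> ?e a b) \<in> tensor_kernel R A B"
      using c by (intro rel) (unfold tensor_relators_def Let_def, blast)
    then show "pure_tensor R A B a (r \<odot>\<^bsub>B\<^esub> b) = r \<odot>\<^bsub>tensor R A B\<^esub> pure_tensor R A B a b"
      using c gen by (simp add: defs quotient_smult) (rule coset_eqI; simp)
  qed
qed

lemma pure_tensor_closed: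
  assumes "module R A" "module R B" "a \<in> carrier A" "b \<in> carrier B"
  shows "pure_tensor R A B a b \<in> carrier (tensor R A B)"
  by (rule bilinear_closed[OF pure_tensor_bilinear[OF assms(1,2)] assms(3,4)])

text \<open>Pure tensors are the images of the generators of the free module, so they span the tensor
  product, and linear maps out of it may be compared on them.\<close>

lemma tensor_ext:
  assumes "module R A" "module R B" "module R M"
    and h: "h \<in> linear_maps R (tensor R A B) M" and k: "k \<in> linear_maps R (tensor R A B) M"
    and eq: "\<And>a b. a \<in> carrier A \<Longrightarrow> b \<in> carrier B \<Longrightarrow>
      h (pure_tensor R A B a b) = k (pure_tensor R A B a b)"
    and t: "t \<in> carrier (tensor R A B)"
  shows "h t = k t"
proof -
  interpret A: module R A by fact
  interpret quotient R "free_module R (carrier A \<times> carrier B)" "tensor_kernel R A B"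
    using tensor_quotient[OF assms(1,2)] .
  let ?Fr = "free_module R (carrier A \<times> carrier B)"
  let ?\<pi> = "\<lambda>f. tensor_kernel R A B +>\<^bsub>?Fr\<^esub> f"
  have \<pi>: "?\<pi> \<in> linear_maps R ?Fr (tensor R A B)"
    unfolding tensor_def by (rule quotient_map_linear)
  obtain f where f: "f \<in> carrier ?Fr" "t = ?\<pi> f"
    using t unfolding tensor_def by (rule quotient_cases)
  have "h (?\<pi> f) = k (?\<pi> f)"
  proof (rule free_module_ext[OF A.R.is_cring assms(3) linear_comp[OF \<pi> h] linear_comp[OF \<pi> k] _ f(1)])
    fix p assume "p \<in> carrier A \<times> carrier B"
    then show "h (?\<pi> (free_gen R p)) = k (?\<pi> (free_gen R p))"
      using eq by (auto simp: pure_tensor_def)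
  qed
  then show ?thesis using f(2) by simp
qed

text \<open>The linear extension of a bilinear map kills every relator, hence the kernel of the
  projection, so its value does not depend on the representative.\<close>

lemma tensor_lift_coset:
  assumes "module R A" "module R B" "module R T" and \<phi>: "bilinear_map R A B T \<phi>"
    and f: "f \<in> carrier (free_module R (carrier A \<times> carrier B))"
  shows "tensor_lift R A B T \<phi> (tensor_kernel R A B +>\<^bsub>free_module R (carrier A \<times> carrier B)\<^esub> f)
    = linear_extension R T (\<lambda>p. \<phi> (fst p) (snd p)) f"
proof -
  interpret A: module R A by fact
  interpret B: module R B by fact
  interpret T: module R T by fact
  interpret quotient R "free_module R (carrier A \<times> carrier B)" "tensor_kernel R A B"
    using tensor_quotient[OF assms(1,2)] .
  let ?Fr = "free_module R (carrier A \<times> carrier B)"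
  let ?L = "linear_extension R T (\<lambda>p. \<phi> (fst p) (snd p))"
  have cl: "\<phi> a b \<in> carrier T" if "a \<in> carrier A" "b \<in> carrier B" for a b
    using bilinear_closed[OF \<phi> that] .
  have L: "?L \<in> linear_maps R ?Fr T"
    by (rule linear_extension_linear[OF assms(3)]) (auto intro: cl)
  have Lgen: "?L (free_gen R (a, b)) = \<phi> a b" if "a \<in> carrier A" "b \<in> carrier B" for a b
    using that cl by (subst linear_extension_gen[OF assms(3), where X = "carrier A \<times> carrier B"]) auto
  have gen: "free_gen R (a, b) \<in> carrier ?Fr" if "a \<in> carrier A" "b \<in> carrier B" for a b
    using that by (intro free_gen_closed A.R.is_cring) simp
  note lm = linear_minus[OF module_axioms assms(3) L] linear_add[OF L] linear_smult[OF L]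
  have zero: "y \<ominus>\<^bsub>T\<^esub> y = \<zero>\<^bsub>T\<^esub>" if "y \<in> carrier T" for y
    using that by (simp add: T.minus_eq T.r_neg)
  have "tensor_relators R A B \<subseteq> {f \<in> carrier ?Fr. ?L f = \<zero>\<^bsub>T\<^esub>}"
    using tensor_relators_closed[OF assms(1,2)]
    by (auto simp: tensor_relators_def Let_def lm gen Lgen cl zero
        linear_add[OF bilinear_right[OF \<phi>]] linear_add[OF bilinear_left[OF \<phi>]]
        linear_smult[OF bilinear_right[OF \<phi>]] linear_smult[OF bilinear_left[OF \<phi>]])
  then have "tensor_kernel R A B \<subseteq> {f \<in> carrier ?Fr. ?L f = \<zero>\<^bsub>T\<^esub>}"
    unfolding tensor_kernel_def
    by (intro submodule_span_least kernel_submodule module_axioms assms(3) L)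
  then have "?L ` (tensor_kernel R A B +>\<^bsub>?Fr\<^esub> f) = {?L f}"
    by (intro linear_constant_on_coset[OF assms(3) L _ f]) auto
  then show ?thesis
    by (simp add: tensor_lift_def linear_extension_def[abs_def])
qed

lemma tensor_lift_linear:
  assumes "module R A" "module R B" "module R T" and \<phi>: "bilinear_map R A B T \<phi>"
  shows "tensor_lift R A B T \<phi> \<in> linear_maps R (tensor R A B) T"
proof -
  interpret T: module R T by fact
  interpret quotient R "free_module R (carrier A \<times> carrier B)" "tensor_kernel R A B"
    using tensor_quotient[OF assms(1,2)] .
  let ?Fr = "free_module R (carrier A \<times> carrier B)"
  let ?L = "linear_extension R T (\<lambda>p. \<phi> (fst p) (snd p))"
  have cl: "\<phi> a b \<in> carrier T" if "a \<in> carrier A" "b \<in> carrier B" for a b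
    using bilinear_closed[OF \<phi> that] .
  have L: "?L \<in> linear_maps R ?Fr T"
    by (rule linear_extension_linear[OF assms(3)]) (auto intro: cl)
  note lift = tensor_lift_coset[OF assms]
  show ?thesis
    by (rule linear_mapsI)
       (auto elim!: quotient_cases simp: tensor_def quotient_add quotient_smult lift
          linear_closed[OF L] linear_add[OF L] linear_smult[OF L])
qed

lemma tensor_lift_pure:
  assumes "module R A" "module R B" "module R T" and \<phi>: "bilinear_map R A B T \<phi>"
    and "a \<in> carrier A" "b \<in> carrier B"
  shows "tensor_lift R A B T \<phi> (pure_tensor R A B a b) = \<phi> a b"
proof -
  interpret T: module R T by fact
  let ?X = "carrier A \<times> carrier B" and ?g = "\<lambda>p. \<phi> (fst p) (snd p)"
  have ab: "(a, b) \<in> ?X" using assms(5,6) by simp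
  have "?g p \<in> carrier T" if "p \<in> ?X" for p
    using that bilinear_closed[OF \<phi>] by auto
  then have "linear_extension R T ?g (free_gen R (a, b)) = ?g (a, b)"
    by (intro linear_extension_gen[OF assms(3) _ ab])
  then show ?thesis
    by (simp add: pure_tensor_def
        tensor_lift_coset[OF assms(1-4) free_gen_closed[OF T.R.is_cring ab]])
qed

section \<open>Maps between tensor products\<close>

lemma tensor_map_bilinear:
  assumes "module R C" "module R D" "f \<in> linear_maps R A C" "g \<in> linear_maps R B D"
  shows "bilinear_map R A B (tensor R C D) (\<lambda>a b. pure_tensor R C D (f a) (g b))"
  by (rule bilinear_precomp[OF pure_tensor_bilinear[OF assms(1,2)] assms(3,4)])

lemma tensor_map_linear:
  assumes "module R A" "module R B" "module R C" "module R D"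
    and "f \<in> linear_maps R A C" "g \<in> linear_maps R B D"
  shows "tensor_map R A B C D f g \<in> linear_maps R (tensor R A B) (tensor R C D)"
  unfolding tensor_map_def
  by (rule tensor_lift_linear[OF assms(1,2) tensor_module[OF assms(3,4)]
        tensor_map_bilinear[OF assms(3-6)]])

lemma tensor_map_pure:
  assumes "module R A" "module R B" "module R C" "module R D"
    and "f \<in> linear_maps R A C" "g \<in> linear_maps R B D"
    and "a \<in> carrier A" "b \<in> carrier B"
  shows "tensor_map R A B C D f g (pure_tensor R A B a b) = pure_tensor R C D (f a) (g b)"
  unfolding tensor_map_def
  by (rule tensor_lift_pure[OF assms(1,2) tensor_module[OF assms(3,4)]
        tensor_map_bilinear[OF assms(3-6)] assms(7,8)])

lemma tensor_map_comp:
  assumes mods: "module R A" "module R B" "module R C" "module R D" "module R E" "module R H"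
    and f: "f \<in> linear_maps R A C" "f' \<in> linear_maps R C E"
    and g: "g \<in> linear_maps R B D" "g' \<in> linear_maps R D H"
    and t: "t \<in> carrier (tensor R A B)"
  shows "tensor_map R C D E H f' g' (tensor_map R A B C D f g t)
    = tensor_map R A B E H (\<lambda>a. f' (f a)) (\<lambda>b. g' (g b)) t"
proof (rule tensor_ext[OF mods(1,2) tensor_module[OF mods(5,6)] _ _ _ t])
  show "(\<lambda>t. tensor_map R C D E H f' g' (tensor_map R A B C D f g t))
      \<in> linear_maps R (tensor R A B) (tensor R E H)"
    by (rule linear_comp[OF tensor_map_linear[OF mods(1-4) f(1) g(1)]
          tensor_map_linear[OF mods(3-6) f(2) g(2)]])
  show "tensor_map R A B E H (\<lambda>a. f' (f a)) (\<lambda>b. g' (g b))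
      \<in> linear_maps R (tensor R A B) (tensor R E H)"
    by (intro tensor_map_linear mods linear_comp[OF f] linear_comp[OF g])
  fix a b assume ab: "a \<in> carrier A" "b \<in> carrier B"
  show "tensor_map R C D E H f' g' (tensor_map R A B C D f g (pure_tensor R A B a b))
      = tensor_map R A B E H (\<lambda>a. f' (f a)) (\<lambda>b. g' (g b)) (pure_tensor R A B a b)"
    using ab by (simp add: tensor_map_pure mods f g linear_closed[OF f(1)] linear_closed[OF g(1)]
        linear_comp[OF f] linear_comp[OF g])
qed

lemma tensor_swap_linear:
  assumes "module R A" "module R B"
  shows "tensor_swap R A B \<in> linear_maps R (tensor R A B) (tensor R B A)"
  unfolding tensor_swap_def
  by (intro tensor_lift_linear tensor_module assms
      bilinear_flip[OF pure_tensor_bilinear[OF assms(2,1)]])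

lemma tensor_swap_pure:
  assumes "module R A" "module R B" "a \<in> carrier A" "b \<in> carrier B"
  shows "tensor_swap R A B (pure_tensor R A B a b) = pure_tensor R B A b a"
  unfolding tensor_swap_def
  by (intro tensor_lift_pure tensor_module assms
      bilinear_flip[OF pure_tensor_bilinear[OF assms(2,1)]])

section \<open>Trilinear maps and triple tensor products\<close>

text \<open>The three slots are treated alike, so that permuting the arguments of a trilinear map
  visibly gives a trilinear map; \<open>bilinear_map\<close> applied twice would hide this.\<close>

definition trilinear_map ::
  "('r, 'm) ring_scheme \<Rightarrow> ('r, 'a, 'n) module_scheme \<Rightarrow> ('r, 'b, 'p) module_scheme \<Rightarrow>
     ('r, 'c, 'q) module_scheme \<Rightarrow> ('r, 't, 's) module_scheme \<Rightarrow> ('a \<Rightarrow> 'b \<Rightarrow> 'c \<Rightarrow> 't) \<Rightarrow> bool"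
  where "trilinear_map R A B C T \<phi> \<longleftrightarrow>
    (\<forall>b\<in>carrier B. \<forall>c\<in>carrier C. (\<lambda>a. \<phi> a b c) \<in> linear_maps R A T) \<and>
    (\<forall>a\<in>carrier A. \<forall>c\<in>carrier C. (\<lambda>b. \<phi> a b c) \<in> linear_maps R B T) \<and>
    (\<forall>a\<in>carrier A. \<forall>b\<in>carrier B. (\<lambda>c. \<phi> a b c) \<in> linear_maps R C T)"

lemma trilinear_fix_third:
  "trilinear_map R A B C T \<phi> \<Longrightarrow> c \<in> carrier C \<Longrightarrow> bilinear_map R A B T (\<lambda>a b. \<phi> a b c)"
  by (simp add: trilinear_map_def bilinear_map_def)

lemma trilinear_fix_first:
  "trilinear_map R A B C T \<phi> \<Longrightarrow> a \<in> carrier A \<Longrightarrow> bilinear_map R B C T (\<phi> a)"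
  by (simp add: trilinear_map_def bilinear_map_def)

text \<open>If a family of bilinear maps depends linearly on a parameter, so do the induced maps at a
  fixed tensor \<open>u\<close>: for a pure \<open>u\<close> this is the hypothesis, and both sides are linear in \<open>u\<close>.
  This yields both ways of grouping the arguments of a trilinear map.\<close>

lemma tensor_lift_linear_in_parameter:
  assumes mods: "module R A" "module R B" "module R T"
    and \<phi>: "\<And>c. c \<in> carrier C \<Longrightarrow> bilinear_map R A B T (\<phi> c)"
    and c_linear: "\<And>a b. a \<in> carrier A \<Longrightarrow> b \<in> carrier B \<Longrightarrow> (\<lambda>c. \<phi> c a b) \<in> linear_maps R C T"
    and C: "module R C" and u: "u \<in> carrier (tensor R A B)"
  shows "(\<lambda>c. tensor_lift R A B T (\<phi> c) u) \<in> linear_maps R C T"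
proof -
  interpret C: module R C by fact
  note lin = tensor_lift_linear[OF mods \<phi>] and pure = tensor_lift_pure[OF mods \<phi>]
  show ?thesis
  proof (rule linear_mapsI)
    fix c assume "c \<in> carrier C"
    then show "tensor_lift R A B T (\<phi> c) u \<in> carrier T"
      by (rule linear_closed[OF lin u])
  next
    fix c d assume cd: "c \<in> carrier C" "d \<in> carrier C"
    show "tensor_lift R A B T (\<phi> (c \<oplus>\<^bsub>C\<^esub> d)) u
        = tensor_lift R A B T (\<phi> c) u \<oplus>\<^bsub>T\<^esub> tensor_lift R A B T (\<phi> d) u"
      using cd by (intro tensor_ext[OF mods lin linear_sum[OF mods(3) lin lin] _ u])
        (simp_all add: pure linear_add[OF c_linear])
  next
    fix r c assume rc: "r \<in> carrier R" "c \<in> carrier C"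
    show "tensor_lift R A B T (\<phi> (r \<odot>\<^bsub>C\<^esub> c)) u = r \<odot>\<^bsub>T\<^esub> tensor_lift R A B T (\<phi> c) u"
      using rc by (intro tensor_ext[OF mods lin linear_scaled[OF mods(3) _ lin] _ u])
        (simp_all add: pure linear_smult[OF c_linear])
  qed
qed

lemma trilinear_curry_left:
  assumes mods: "module R A" "module R B" "module R C" "module R T"
    and \<phi>: "trilinear_map R A B C T \<phi>"
  shows "bilinear_map R (tensor R A B) C T (\<lambda>u c. tensor_lift R A B T (\<lambda>a b. \<phi> a b c) u)"
proof (rule bilinear_mapI)
  fix c assume "c \<in> carrier C"
  then show "(\<lambda>u. tensor_lift R A B T (\<lambda>a b. \<phi> a b c) u) \<in> linear_maps R (tensor R A B) T"
    by (intro tensor_lift_linear mods trilinear_fix_third[OF \<phi>])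
next
  fix u assume "u \<in> carrier (tensor R A B)"
  then show "(\<lambda>c. tensor_lift R A B T (\<lambda>a b. \<phi> a b c) u) \<in> linear_maps R C T"
    using \<phi> by (intro tensor_lift_linear_in_parameter mods trilinear_fix_third[OF \<phi>])
      (simp_all add: trilinear_map_def)
qed

lemma trilinear_curry_right:
  assumes mods: "module R A" "module R B" "module R C" "module R T"
    and \<phi>: "trilinear_map R A B C T \<phi>"
  shows "bilinear_map R A (tensor R B C) T (\<lambda>a. tensor_lift R B C T (\<phi> a))"
proof (rule bilinear_mapI)
  fix a assume "a \<in> carrier A"
  then show "tensor_lift R B C T (\<phi> a) \<in> linear_maps R (tensor R B C) T"
    by (intro tensor_lift_linear mods trilinear_fix_first[OF \<phi>])
next
  fix u assume "u \<in> carrier (tensor R B C)"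
  then show "(\<lambda>a. tensor_lift R B C T (\<phi> a) u) \<in> linear_maps R A T"
    using \<phi> by (intro tensor_lift_linear_in_parameter mods trilinear_fix_first[OF \<phi>])
      (simp_all add: trilinear_map_def)
qed

lemma tensor_lift3_linear:
  assumes mods: "module R A" "module R B" "module R C" "module R T"
    and \<phi>: "trilinear_map R A B C T \<phi>"
  shows "tensor_lift3 R A B C T \<phi> \<in> linear_maps R (tensor R (tensor R A B) C) T"
  unfolding tensor_lift3_def
  by (intro tensor_lift_linear tensor_module trilinear_curry_left mods \<phi>)

lemma tensor_lift3_pure:
  assumes mods: "module R A" "module R B" "module R C" "module R T"
    and \<phi>: "trilinear_map R A B C T \<phi>"
    and abc: "a \<in> carrier A" "b \<in> carrier B" "c \<in> carrier C"
  shows "tensor_lift3 R A B C T \<phi>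
      (pure_tensor R (tensor R A B) C (pure_tensor R A B a b) c) = \<phi> a b c"
proof -
  have "tensor_lift3 R A B C T \<phi> (pure_tensor R (tensor R A B) C (pure_tensor R A B a b) c)
      = tensor_lift R A B T (\<lambda>a b. \<phi> a b c) (pure_tensor R A B a b)"
    unfolding tensor_lift3_def
    by (intro tensor_lift_pure tensor_module trilinear_curry_left mods \<phi> pure_tensor_closed abc)
  also have "\<dots> = \<phi> a b c"
    by (intro tensor_lift_pure mods trilinear_fix_third[OF \<phi>] abc)
  finally show ?thesis .
qed

lemma tensor_ext_left_nested:
  assumes mods: "module R A" "module R B" "module R C" "module R M"
    and h: "h \<in> linear_maps R (tensor R (tensor R A B) C) M"
    and k: "k \<in> linear_maps R (tensor R (tensor R A B) C) M"
    and eq: "\<And>a b c. a \<in> carrier A \<Longrightarrow> b \<in> carrier B \<Longrightarrow> c \<in> carrier C \<Longrightarrow>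
      h (pure_tensor R (tensor R A B) C (pure_tensor R A B a b) c) =
      k (pure_tensor R (tensor R A B) C (pure_tensor R A B a b) c)"
    and t: "t \<in> carrier (tensor R (tensor R A B) C)"
  shows "h t = k t"
proof (rule tensor_ext[OF tensor_module[OF mods(1,2)] mods(3,4) h k _ t])
  fix u c assume u: "u \<in> carrier (tensor R A B)" and c: "c \<in> carrier C"
  have p: "(\<lambda>u. pure_tensor R (tensor R A B) C u c)
      \<in> linear_maps R (tensor R A B) (tensor R (tensor R A B) C)"
    by (intro bilinear_left[OF pure_tensor_bilinear] tensor_module mods c)
  show "h (pure_tensor R (tensor R A B) C u c) = k (pure_tensor R (tensor R A B) C u c)"
    by (rule tensor_ext[OF mods(1,2,4) linear_comp[OF p h] linear_comp[OF p k] eq u]) (simp_all add: c)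
qed

lemma tensor_ext_right_nested:
  assumes mods: "module R A" "module R B" "module R C" "module R M"
    and h: "h \<in> linear_maps R (tensor R A (tensor R B C)) M"
    and k: "k \<in> linear_maps R (tensor R A (tensor R B C)) M"
    and eq: "\<And>a b c. a \<in> carrier A \<Longrightarrow> b \<in> carrier B \<Longrightarrow> c \<in> carrier C \<Longrightarrow>
      h (pure_tensor R A (tensor R B C) a (pure_tensor R B C b c)) =
      k (pure_tensor R A (tensor R B C) a (pure_tensor R B C b c))"
    and t: "t \<in> carrier (tensor R A (tensor R B C))"
  shows "h t = k t"
proof (rule tensor_ext[OF mods(1) tensor_module[OF mods(2,3)] mods(4) h k _ t])
  fix a u assume a: "a \<in> carrier A" and u: "u \<in> carrier (tensor R B C)"
  have p: "pure_tensor R A (tensor R B C) a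
      \<in> linear_maps R (tensor R B C) (tensor R A (tensor R B C))"
    by (intro bilinear_right[OF pure_tensor_bilinear] tensor_module mods a)
  show "h (pure_tensor R A (tensor R B C) a u) = k (pure_tensor R A (tensor R B C) a u)"
    by (rule tensor_ext[OF mods(2,3,4) linear_comp[OF p h] linear_comp[OF p k] eq u]) (simp_all add: a)
qed

section \<open>Permutations of the tensor cube\<close>

locale tensor_cube = module R A for R (structure) and A (structure)
begin

abbreviation "T2 \<equiv> tensor R A A"
abbreviation "T3 \<equiv> tensor R T2 A"
abbreviation "P3 \<equiv> pure_tensor3 R A"

text \<open>The five nontrivial permutations of the factors. Their defining functions are those of the
  left Alia identity, so that each term of it is one of these maps applied to the same tensor.\<close>

definition "swap12 = tensor_lift3 R A A A T3 (\<lambda>a b c. P3 b a c)"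
definition "swap23 = tensor_lift3 R A A A T3 (\<lambda>a b c. P3 a c b)"
definition "swap13 = tensor_lift3 R A A A T3 (\<lambda>a b c. P3 c b a)"
definition "rot_left = tensor_lift3 R A A A T3 (\<lambda>a b c. P3 b c a)"
definition "rot_right = tensor_lift3 R A A A T3 (\<lambda>a b c. P3 c a b)"

lemma A_module: "module R A" by (rule module_axioms)
lemma T2_module: "module R T2" by (rule tensor_module[OF A_module A_module])
lemma T3_module: "module R T3" by (rule tensor_module[OF T2_module A_module])

lemma pure_tensor3_linear:
  assumes "a \<in> carrier A" "b \<in> carrier A"
  shows "(\<lambda>x. P3 x a b) \<in> linear_maps R A T3"
    and "(\<lambda>x. P3 a x b) \<in> linear_maps R A T3"
    and "(\<lambda>x. P3 a b x) \<in> linear_maps R A T3"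
proof -
  have left: "(\<lambda>u. pure_tensor R T2 A u c) \<in> linear_maps R T2 T3" if "c \<in> carrier A" for c
    by (rule bilinear_left[OF pure_tensor_bilinear[OF T2_module A_module] that])
  show "(\<lambda>x. P3 x a b) \<in> linear_maps R A T3" "(\<lambda>x. P3 a x b) \<in> linear_maps R A T3"
    unfolding pure_tensor3_def
    by (rule linear_comp[OF bilinear_left[OF pure_tensor_bilinear[OF A_module A_module]
            assms(1)] left[OF assms(2)]],
        rule linear_comp[OF bilinear_right[OF pure_tensor_bilinear[OF A_module A_module]
            assms(1)] left[OF assms(2)]])
  show "(\<lambda>x. P3 a b x) \<in> linear_maps R A T3"
    unfolding pure_tensor3_def
    by (rule bilinear_right[OF pure_tensor_bilinear[OF T2_module A_module]
          pure_tensor_closed[OF A_module A_module assms]])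
qed

lemma trilinear_permuted:
  "trilinear_map R A A A T3 (\<lambda>a b c. P3 a b c)"
  "trilinear_map R A A A T3 (\<lambda>a b c. P3 b a c)"
  "trilinear_map R A A A T3 (\<lambda>a b c. P3 a c b)"
  "trilinear_map R A A A T3 (\<lambda>a b c. P3 c b a)"
  "trilinear_map R A A A T3 (\<lambda>a b c. P3 b c a)"
  "trilinear_map R A A A T3 (\<lambda>a b c. P3 c a b)"
  unfolding trilinear_map_def by (simp_all add: pure_tensor3_linear)

lemma
  shows swap12_linear: "swap12 \<in> linear_maps R T3 T3"
    and swap23_linear: "swap23 \<in> linear_maps R T3 T3"
    and swap13_linear: "swap13 \<in> linear_maps R T3 T3"
    and rot_left_linear: "rot_left \<in> linear_maps R T3 T3"
    and rot_right_linear: "rot_right \<in> linear_maps R T3 T3"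
  unfolding swap12_def swap23_def swap13_def rot_left_def rot_right_def
  by (intro tensor_lift3_linear A_module T3_module trilinear_permuted)+

lemmas perm_linear = swap12_linear swap23_linear swap13_linear rot_left_linear rot_right_linear

lemma perm_pure:
  assumes "a \<in> carrier A" "b \<in> carrier A" "c \<in> carrier A"
  shows "swap12 (P3 a b c) = P3 b a c"
    and "swap23 (P3 a b c) = P3 a c b"
    and "swap13 (P3 a b c) = P3 c b a"
    and "rot_left (P3 a b c) = P3 b c a"
    and "rot_right (P3 a b c) = P3 c a b"
  unfolding swap12_def swap23_def swap13_def rot_left_def rot_right_def pure_tensor3_def[of R A a b c]
  by (rule tensor_lift3_pure[OF A_module A_module A_module T3_module _ assms],
      rule trilinear_permuted)+

lemma cube_ext:
  assumes "h \<in> linear_maps R T3 T3" "k \<in> linear_maps R T3 T3"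
    and "\<And>a b c. a \<in> carrier A \<Longrightarrow> b \<in> carrier A \<Longrightarrow> c \<in> carrier A \<Longrightarrow> h (P3 a b c) = k (P3 a b c)"
    and "t \<in> carrier T3"
  shows "h t = k t"
  by (rule tensor_ext_left_nested[OF A_module A_module A_module T3_module assms(1,2) _ assms(4)])
     (use assms(3) in \<open>simp add: pure_tensor3_def\<close>)

lemma perm_comp:
  assumes t: "t \<in> carrier T3"
  shows "swap23 (swap12 t) = rot_left t" "swap13 (swap12 t) = rot_right t"
    and "swap12 (swap23 t) = rot_right t" "swap13 (swap23 t) = rot_left t"
    and "swap12 (swap13 t) = rot_left t" "swap23 (swap13 t) = rot_right t"
    and "swap12 (swap23 (swap12 t)) = swap13 t"
  by (rule cube_ext[OF linear_comp[OF perm_linear(1) perm_linear(2)] perm_linear(4) _ t],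
      simp add: perm_pure,
      rule cube_ext[OF linear_comp[OF perm_linear(1) perm_linear(3)] perm_linear(5) _ t],
      simp add: perm_pure,
      rule cube_ext[OF linear_comp[OF perm_linear(2) perm_linear(1)] perm_linear(5) _ t],
      simp add: perm_pure,
      rule cube_ext[OF linear_comp[OF perm_linear(2) perm_linear(3)] perm_linear(4) _ t],
      simp add: perm_pure,
      rule cube_ext[OF linear_comp[OF perm_linear(3) perm_linear(1)] perm_linear(4) _ t],
      simp add: perm_pure,
      rule cube_ext[OF linear_comp[OF perm_linear(3) perm_linear(2)] perm_linear(5) _ t],
      simp add: perm_pure,
      rule cube_ext[OF linear_comp[OF linear_comp[OF perm_linear(1) perm_linear(2)]
          perm_linear(1)] perm_linear(3) _ t],
      simp add: perm_pure)

text \<open>The signed sum over the symmetric group vanishes, written without subtraction as odd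
  permutations against even ones, in the order of the left Alia identity.\<close>

definition antisymmetrizes_to_zero :: "(('c \<times> 'c \<Rightarrow> 'a) set \<times> 'c \<Rightarrow> 'a) set \<Rightarrow> bool"
  where "antisymmetrizes_to_zero t \<longleftrightarrow>
    swap12 t \<oplus>\<^bsub>T3\<^esub> swap23 t \<oplus>\<^bsub>T3\<^esub> swap13 t = t \<oplus>\<^bsub>T3\<^esub> rot_left t \<oplus>\<^bsub>T3\<^esub> rot_right t"

text \<open>Both sides of the condition are additive, so it may be checked on the summands of a tensor.\<close>

lemma antisymmetrizes_to_zero_add:
  assumes s: "s \<in> carrier T3" "antisymmetrizes_to_zero s" and t: "t \<in> carrier T3" "antisymmetrizes_to_zero t"
  shows "antisymmetrizes_to_zero (s \<oplus>\<^bsub>T3\<^esub> t)"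
proof -
  interpret T3: module R T3 by (rule T3_module)
  have interchange: "(u1 \<oplus>\<^bsub>T3\<^esub> v1) \<oplus>\<^bsub>T3\<^esub> (u2 \<oplus>\<^bsub>T3\<^esub> v2) \<oplus>\<^bsub>T3\<^esub> (u3 \<oplus>\<^bsub>T3\<^esub> v3)
      = (u1 \<oplus>\<^bsub>T3\<^esub> u2 \<oplus>\<^bsub>T3\<^esub> u3) \<oplus>\<^bsub>T3\<^esub> (v1 \<oplus>\<^bsub>T3\<^esub> v2 \<oplus>\<^bsub>T3\<^esub> v3)"
    if "u1 \<in> carrier T3" "u2 \<in> carrier T3" "u3 \<in> carrier T3"
      "v1 \<in> carrier T3" "v2 \<in> carrier T3" "v3 \<in> carrier T3" for u1 u2 u3 v1 v2 v3
    using that by (simp add: T3.a_ac)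
  note add = linear_add[OF _ s(1) t(1)]
  show ?thesis
    using s t
    by (simp add: antisymmetrizes_to_zero_def add[OF perm_linear(1)] add[OF perm_linear(2)]
        add[OF perm_linear(3)] add[OF perm_linear(4)] add[OF perm_linear(5)]
        interchange perm_linear[THEN linear_closed])
qed

text \<open>If a transposition \<open>\<tau>\<close> fixes \<open>t\<close>, then \<open>\<sigma> t = \<sigma> (\<tau> t)\<close> for every \<open>\<sigma>\<close>, so the three odd images
  of \<open>t\<close> coincide with the three even ones.\<close>

lemma fixed_antisymmetrizes_to_zero:
  assumes t: "t \<in> carrier T3" and fixed: "swap12 t = t \<or> swap23 t = t \<or> swap13 t = t"
  shows "antisymmetrizes_to_zero t"
proof -
  interpret T3: module R T3 by (rule T3_module)
  note [simp] = t perm_linear[THEN linear_closed]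
  from fixed consider "swap12 t = t" | "swap23 t = t" | "swap13 t = t" by blast
  then show ?thesis
  proof cases
    case 1
    then have "swap23 t = rot_left t" "swap13 t = rot_right t"
      using perm_comp(1,2)[OF t] by simp_all
    with 1 show ?thesis by (simp add: antisymmetrizes_to_zero_def)
  next
    case 2
    then have "swap12 t = rot_right t" "swap13 t = rot_left t"
      using perm_comp(3,4)[OF t] by simp_all
    with 2 show ?thesis by (simp add: antisymmetrizes_to_zero_def T3.a_ac)
  next
    case 3
    then have "swap12 t = rot_left t" "swap23 t = rot_right t"
      using perm_comp(5,6)[OF t] by simp_all
    with 3 show ?thesis by (simp add: antisymmetrizes_to_zero_def T3.a_ac)
  qed
qed

text \<open>A left inverse of the associativity map. Coassociativity compares elements of
  \<open>A \<otimes> (A \<otimes> A)\<close>, and this carries them back to the left-bracketed cube where the permutations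
  act.\<close>

definition "unassoc = tensor_lift R A T2 T3 (\<lambda>a. tensor_lift R A A T3 (P3 a))"

lemma unassoc_bilinear:
  "bilinear_map R A T2 T3 (\<lambda>a. tensor_lift R A A T3 (P3 a))"
  by (rule trilinear_curry_right[OF A_module A_module A_module T3_module trilinear_permuted(1)])

lemma unassoc_linear: "unassoc \<in> linear_maps R (tensor R A T2) T3"
  unfolding unassoc_def
  by (rule tensor_lift_linear[OF A_module T2_module T3_module unassoc_bilinear])

lemma unassoc_pure:
  assumes "a \<in> carrier A" "b \<in> carrier A" "c \<in> carrier A"
  shows "unassoc (pure_tensor R A T2 a (pure_tensor R A A b c)) = P3 a b c"
proof -
  have "unassoc (pure_tensor R A T2 a (pure_tensor R A A b c))
      = tensor_lift R A A T3 (P3 a) (pure_tensor R A A b c)"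
    unfolding unassoc_def
    by (rule tensor_lift_pure[OF A_module T2_module T3_module unassoc_bilinear assms(1)
          pure_tensor_closed[OF A_module A_module assms(2,3)]])
  also have "\<dots> = P3 a b c"
    by (rule tensor_lift_pure[OF A_module A_module T3_module
          trilinear_fix_first[OF trilinear_permuted(1) assms(1)] assms(2,3)])
  finally show ?thesis .
qed

lemma assoc_trilinear:
  "trilinear_map R A A A (tensor R A T2)
    (\<lambda>a b c. pure_tensor R A T2 a (pure_tensor R A A b c))"
proof -
  note pt = pure_tensor_bilinear[OF A_module A_module]
    and pt' = pure_tensor_bilinear[OF A_module T2_module]
  show ?thesis
    unfolding trilinear_map_def
    using bilinear_left[OF pt'] bilinear_closed[OF pt]
      linear_comp[OF bilinear_left[OF pt] bilinear_right[OF pt']]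
      linear_comp[OF bilinear_right[OF pt] bilinear_right[OF pt']]
    by auto
qed

lemma assoc_linear: "tensor_assoc R A A A \<in> linear_maps R T3 (tensor R A T2)"
  unfolding tensor_assoc_def
  by (rule tensor_lift3_linear[OF A_module A_module A_module
        tensor_module[OF A_module T2_module] assoc_trilinear])

lemma assoc_pure:
  assumes "a \<in> carrier A" "b \<in> carrier A" "c \<in> carrier A"
  shows "tensor_assoc R A A A (P3 a b c) = pure_tensor R A T2 a (pure_tensor R A A b c)"
  unfolding tensor_assoc_def pure_tensor3_def
  by (rule tensor_lift3_pure[OF A_module A_module A_module
        tensor_module[OF A_module T2_module] assoc_trilinear assms])

lemma unassoc_assoc: "t \<in> carrier T3 \<Longrightarrow> unassoc (tensor_assoc R A A A t) = t"
  by (rule cube_ext[OF linear_comp[OF assoc_linear unassoc_linear] linear_id[unfolded id_def]])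
     (simp_all add: assoc_pure unassoc_pure)

lemma swap_linear: "tensor_swap R A A \<in> linear_maps R T2 T2"
  by (rule tensor_swap_linear[OF A_module A_module])

lemma swap23_unassoc:
  assumes "z \<in> carrier (tensor R A T2)"
  shows "swap23 (unassoc z) = unassoc (tensor_map R A T2 A T2 id (tensor_swap R A A) z)"
proof -
  note mods = A_module T2_module A_module T2_module
  note tm = tensor_map_linear[OF mods linear_id swap_linear]
  show ?thesis
    by (rule tensor_ext_right_nested[OF A_module A_module A_module T3_module
          linear_comp[OF unassoc_linear perm_linear(2)] linear_comp[OF tm unassoc_linear] _ assms])
       (simp add: tensor_map_pure[OF mods linear_id swap_linear] pure_tensor_closed[OF A_module A_module]
          tensor_swap_pure[OF A_module A_module] unassoc_pure perm_pure)
qed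

lemma swap12_pure:
  assumes "u \<in> carrier T2" "c \<in> carrier A"
  shows "swap12 (pure_tensor R T2 A u c) = pure_tensor R T2 A (tensor_swap R A A u) c"
proof -
  have p: "(\<lambda>u. pure_tensor R T2 A u c) \<in> linear_maps R T2 T3"
    by (rule bilinear_left[OF pure_tensor_bilinear[OF T2_module A_module] assms(2)])
  show ?thesis
    using assms(2)
    by (intro tensor_ext[OF A_module A_module T3_module linear_comp[OF p perm_linear(1)]
          linear_comp[OF swap_linear p] _ assms(1)])
       (simp add: tensor_swap_pure[OF A_module A_module] perm_pure[unfolded pure_tensor3_def])
qed

end

section \<open>Cocommutative coassociative coalgebras\<close>

locale cocommutative_cube =
  tensor_cube R A + cocommutative_coassociative_coalgebra R A \<delta>
  for R (structure) and A (structure) and \<delta>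
begin

abbreviation "\<delta>_left \<equiv> tensor_map R A A T2 A \<delta> id"

lemma \<delta>_left_linear: "\<delta>_left \<in> linear_maps R T2 T3"
  by (rule tensor_map_linear[OF A_module A_module T2_module A_module comult_linear linear_id])

lemma \<delta>_left_pure:
  "a \<in> carrier A \<Longrightarrow> b \<in> carrier A \<Longrightarrow> \<delta>_left (pure_tensor R A A a b) = pure_tensor R T2 A (\<delta> a) b"
  using tensor_map_pure[OF A_module A_module T2_module A_module comult_linear linear_id, of a b]
  by simp

text \<open>On \<open>a \<otimes> b\<close> both sides are \<open>\<delta> a \<otimes> b\<close>, because \<open>\<delta> a\<close> is symmetric.\<close>

lemma swap12_fixes:
  assumes "w \<in> carrier T2"
  shows "swap12 (\<delta>_left w) = \<delta>_left w"
  by (rule tensor_ext[OF A_module A_module T3_module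
        linear_comp[OF \<delta>_left_linear perm_linear(1)] \<delta>_left_linear _ assms])
     (simp add: \<delta>_left_pure swap12_pure linear_closed[OF comult_linear] cocommutative)

text \<open>By coassociativity \<open>(\<delta> \<otimes> 1) (\<delta> x)\<close> is \<open>(1 \<otimes> \<delta>) (\<delta> x)\<close> rebracketed, and in the latter form
  the last two factors come from an application of \<open>\<delta>\<close> and may be swapped.\<close>

lemma swap23_fixes:
  assumes x: "x \<in> carrier A"
  shows "swap23 (\<delta>_left (\<delta> x)) = \<delta>_left (\<delta> x)"
proof -
  let ?\<delta>_right = "tensor_map R A A A T2 id \<delta>" and ?\<sigma> = "tensor_map R A T2 A T2 id (tensor_swap R A A)"
  note mods = A_module A_module A_module T2_module
  have dx: "\<delta> x \<in> carrier T2" using linear_closed[OF comult_linear x] .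
  have \<delta>_right: "?\<delta>_right \<in> linear_maps R T2 (tensor R A T2)"
    by (rule tensor_map_linear[OF mods linear_id comult_linear])
  have \<sigma>: "?\<sigma> \<in> linear_maps R (tensor R A T2) (tensor R A T2)"
    by (rule tensor_map_linear[OF A_module T2_module A_module T2_module linear_id swap_linear])
  have sym: "?\<sigma> (?\<delta>_right w) = ?\<delta>_right w" if "w \<in> carrier T2" for w
    by (rule tensor_ext[OF A_module A_module tensor_module[OF A_module T2_module]
          linear_comp[OF \<delta>_right \<sigma>] \<delta>_right _ that])
       (simp add: tensor_map_pure[OF mods linear_id comult_linear]
          tensor_map_pure[OF A_module T2_module A_module T2_module linear_id swap_linear]
          linear_closed[OF comult_linear] cocommutative)
  have u: "\<delta>_left (\<delta> x) = unassoc (?\<delta>_right (\<delta> x))"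
    using unassoc_assoc[OF linear_closed[OF \<delta>_left_linear dx]] coassociative[OF x] by simp
  show ?thesis
    unfolding u by (simp add: swap23_unassoc linear_closed[OF \<delta>_right] dx sym)
qed

text \<open>The transposition of the outer factors is a product of the other two transpositions.\<close>

lemma swap13_fixes:
  assumes x: "x \<in> carrier A"
  shows "swap13 (\<delta>_left (\<delta> x)) = \<delta>_left (\<delta> x)"
proof -
  have dx: "\<delta> x \<in> carrier T2" using linear_closed[OF comult_linear x] .
  show ?thesis
    using perm_comp(7)[OF linear_closed[OF \<delta>_left_linear dx]]
    by (simp add: swap12_fixes[OF dx] swap23_fixes[OF x])
qed

end

section \<open>The special comultiplication\<close>

locale special_cube = cocommutative_cube R A \<delta>
  for R (structure) and A (structure) and \<delta> +
  fixes F G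
  assumes F: "F \<in> linear_maps R A A" and G: "G \<in> linear_maps R A A"
begin

abbreviation "\<Delta> \<equiv> special_comult R A \<delta> F G"
abbreviation map2 (infix \<open>\<otimes>\<otimes>\<close> 75) where "f \<otimes>\<otimes> g \<equiv> tensor_map R A A A A f g"
abbreviation map3 where "map3 f g \<equiv> tensor_map R T2 A T2 A f g"

lemmas map2_linear = tensor_map_linear[OF A_module A_module A_module A_module]
lemmas map2_pure = tensor_map_pure[OF A_module A_module A_module A_module]
lemmas map3_linear = tensor_map_linear[OF T2_module A_module T2_module A_module]
lemmas map3_pure = tensor_map_pure[OF T2_module A_module T2_module A_module]

lemma \<Delta>_linear: "\<Delta> \<in> linear_maps R A T2"
  unfolding special_comult_def[abs_def]
  by (rule linear_sum[OF T2_module linear_comp[OF comult_linear map2_linear[OF linear_id F]]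
        linear_comp[OF G comult_linear]])

text \<open>These are \<open>1 \<otimes> F\<close> on the square, \<open>1 \<otimes> F \<otimes> 1\<close> and \<open>1 \<otimes> F \<otimes> F\<close> on the cube, and \<open>G \<otimes> 1\<close> on
  the square. With \<open>\<delta>_left = \<delta> \<otimes> 1\<close> they express every summand of the iterated \<open>\<Delta>\<close>.\<close>

abbreviation "F_right \<equiv> id \<otimes>\<otimes> F"
abbreviation "F_mid \<equiv> map3 F_right id"
abbreviation "F_last_two \<equiv> map3 F_right F"
abbreviation "G_left \<equiv> G \<otimes>\<otimes> id"

lemma F_right_linear: "F_right \<in> linear_maps R T2 T2" by (rule map2_linear[OF linear_id F])
lemma G_left_linear: "G_left \<in> linear_maps R T2 T2" by (rule map2_linear[OF G linear_id])
lemma F_mid_linear: "F_mid \<in> linear_maps R T3 T3" by (rule map3_linear[OF F_right_linear linear_id])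
lemma F_last_two_linear: "F_last_two \<in> linear_maps R T3 T3" by (rule map3_linear[OF F_right_linear F])

text \<open>From \<open>\<Delta> a = (1 \<otimes> F) (\<delta> a) + \<delta> (G a)\<close>: the first part contributes \<open>1 \<otimes> F \<otimes> 1\<close> applied
  after \<open>\<delta> \<otimes> 1\<close>, the second \<open>G \<otimes> 1\<close> applied before it.\<close>

lemma \<Delta>_left_split:
  assumes "w \<in> carrier T2"
  shows "tensor_map R A A T2 A \<Delta> id w = F_mid (\<delta>_left w) \<oplus>\<^bsub>T3\<^esub> \<delta>_left (G_left w)"
proof (rule tensor_ext[OF A_module A_module T3_module
      tensor_map_linear[OF A_module A_module T2_module A_module \<Delta>_linear linear_id]
      linear_sum[OF T3_module linear_comp[OF \<delta>_left_linear F_mid_linear]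
        linear_comp[OF G_left_linear \<delta>_left_linear]] _ assms])
  fix a b assume ab: "a \<in> carrier A" "b \<in> carrier A"
  have c: "\<delta> a \<in> carrier T2" "G a \<in> carrier A" "\<delta> (G a) \<in> carrier T2"
    using ab linear_closed[OF comult_linear] linear_closed[OF G] by simp_all
  have "tensor_map R A A T2 A \<Delta> id (pure_tensor R A A a b) = pure_tensor R T2 A (\<Delta> a) b"
    using tensor_map_pure[OF A_module A_module T2_module A_module \<Delta>_linear linear_id ab] by simp
  also have "\<dots> = pure_tensor R T2 A (F_right (\<delta> a)) b \<oplus>\<^bsub>T3\<^esub> pure_tensor R T2 A (\<delta> (G a)) b"
    unfolding special_comult_def
    by (rule linear_add[OF bilinear_left[OF pure_tensor_bilinear[OF T2_module A_module] ab(2)]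
          linear_closed[OF F_right_linear c(1)] c(3)])
  also have "\<dots> = F_mid (\<delta>_left (pure_tensor R A A a b)) \<oplus>\<^bsub>T3\<^esub> \<delta>_left (G_left (pure_tensor R A A a b))"
    using ab c by (simp add: \<delta>_left_pure map3_pure[OF F_right_linear linear_id] map2_pure[OF G linear_id])
  finally show "tensor_map R A A T2 A \<Delta> id (pure_tensor R A A a b)
      = F_mid (\<delta>_left (pure_tensor R A A a b)) \<oplus>\<^bsub>T3\<^esub> \<delta>_left (G_left (pure_tensor R A A a b))" .
qed

text \<open>An \<open>F\<close> on the second factor before \<open>\<delta> \<otimes> 1\<close> ends up on the third factor after it.\<close>

lemma F_mid_\<delta>_left_F_right:
  assumes "w \<in> carrier T2"
  shows "F_mid (\<delta>_left (F_right w)) = F_last_two (\<delta>_left w)"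
  by (rule tensor_ext[OF A_module A_module T3_module
        linear_comp[OF linear_comp[OF F_right_linear \<delta>_left_linear] F_mid_linear]
        linear_comp[OF \<delta>_left_linear F_last_two_linear] _ assms])
     (simp add: \<delta>_left_pure map2_pure[OF linear_id F] map3_pure[OF F_right_linear linear_id]
        map3_pure[OF F_right_linear F] linear_closed[OF F] linear_closed[OF comult_linear])

lemma map_P3:
  assumes "a \<in> carrier A" "b \<in> carrier A" "c \<in> carrier A"
  shows "F_mid (P3 a b c) = P3 a (F b) c" "F_last_two (P3 a b c) = P3 a (F b) (F c)"
  using assms
  by (simp_all add: pure_tensor3_def map2_pure[OF linear_id F] map3_pure[OF F_right_linear linear_id]
        map3_pure[OF F_right_linear F] pure_tensor_closed[OF A_module A_module])

lemma swap23_F_last_two: "t \<in> carrier T3 \<Longrightarrow> swap23 (F_last_two t) = F_last_two (swap23 t)"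
  by (rule cube_ext[OF linear_comp[OF F_last_two_linear perm_linear(2)]
        linear_comp[OF perm_linear(2) F_last_two_linear]])
     (simp_all add: map_P3 perm_pure linear_closed[OF F])

lemma swap13_F_mid: "t \<in> carrier T3 \<Longrightarrow> swap13 (F_mid t) = F_mid (swap13 t)"
  by (rule cube_ext[OF linear_comp[OF F_mid_linear perm_linear(3)]
        linear_comp[OF perm_linear(3) F_mid_linear]])
     (simp_all add: map_P3 perm_pure linear_closed[OF F])

text \<open>Each of the four summands is fixed by a transposition: \<open>1 \<otimes> F \<otimes> F\<close> commutes with swapping
  the last two factors and \<open>1 \<otimes> F \<otimes> 1\<close> with swapping the outer two, while \<open>(\<delta> \<otimes> 1) (\<delta> x)\<close> is
  invariant under both; the summands in the image of \<open>\<delta> \<otimes> 1\<close> are covered by \<open>swap12_fixes\<close>.\<close>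

lemma \<Delta>_iterated_antisymmetrizes_to_zero:
  assumes x: "x \<in> carrier A"
  shows "antisymmetrizes_to_zero (tensor_map R A A T2 A \<Delta> id (\<Delta> x))"
proof -
  interpret T3: module R T3 by (rule T3_module)
  let ?y = "G x"
  have y: "?y \<in> carrier A" using linear_closed[OF G x] .
  note \<delta>_closed = linear_closed[OF comult_linear]
  note closed = \<delta>_closed[OF x] \<delta>_closed[OF y] linear_closed[OF F_right_linear] linear_closed[OF G_left_linear]
    linear_closed[OF F_mid_linear] linear_closed[OF F_last_two_linear] linear_closed[OF \<delta>_left_linear]
  have "tensor_map R A A T2 A \<Delta> id (\<Delta> x)
      = tensor_map R A A T2 A \<Delta> id (F_right (\<delta> x)) \<oplus>\<^bsub>T3\<^esub> tensor_map R A A T2 A \<Delta> id (\<delta> ?y)"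
    unfolding special_comult_def[of R A \<delta> F G x]
    by (rule linear_add[OF tensor_map_linear[OF A_module A_module T2_module A_module \<Delta>_linear
          linear_id]]) (simp_all add: closed)
  also have "\<dots> = (F_last_two (\<delta>_left (\<delta> x)) \<oplus>\<^bsub>T3\<^esub> \<delta>_left (G_left (F_right (\<delta> x)))) \<oplus>\<^bsub>T3\<^esub>
      (F_mid (\<delta>_left (\<delta> ?y)) \<oplus>\<^bsub>T3\<^esub> \<delta>_left (G_left (\<delta> ?y)))"
    by (simp add: \<Delta>_left_split F_mid_\<delta>_left_F_right closed)
  also have "antisymmetrizes_to_zero \<dots>"
  proof (intro antisymmetrizes_to_zero_add fixed_antisymmetrizes_to_zero)
    show "swap12 (F_last_two (\<delta>_left (\<delta> x))) = F_last_two (\<delta>_left (\<delta> x)) \<or>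
        swap23 (F_last_two (\<delta>_left (\<delta> x))) = F_last_two (\<delta>_left (\<delta> x)) \<or>
        swap13 (F_last_two (\<delta>_left (\<delta> x))) = F_last_two (\<delta>_left (\<delta> x))"
      by (simp add: swap23_F_last_two swap23_fixes x closed)
    show "swap12 (F_mid (\<delta>_left (\<delta> ?y))) = F_mid (\<delta>_left (\<delta> ?y)) \<or>
        swap23 (F_mid (\<delta>_left (\<delta> ?y))) = F_mid (\<delta>_left (\<delta> ?y)) \<or>
        swap13 (F_mid (\<delta>_left (\<delta> ?y))) = F_mid (\<delta>_left (\<delta> ?y))"
      by (simp add: swap13_F_mid swap13_fixes y closed)
  qed (simp_all add: swap12_fixes closed)
  finally show ?thesis .
qed

lemma special_left_alia: "left_alia_coalgebra R A \<Delta>"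
proof -
  have "comultiplication R A \<Delta>"
    using \<Delta>_linear char_zero_vector_space_axioms
    by (simp add: comultiplication_def comultiplication_axioms_def)
  then show ?thesis
    using \<Delta>_iterated_antisymmetrizes_to_zero
    by (simp add: left_alia_coalgebra_def left_alia_coalgebra_axioms_def sweedler3_def
        antisymmetrizes_to_zero_def swap12_def swap23_def swap13_def rot_left_def rot_right_def)
qed

text \<open>Expanding \<open>\<Delta>\<close> and moving \<open>1 \<otimes> F\<close> to the front turns both sides into \<open>1 \<otimes> F\<close> applied to a side
  of the Nijenhuis identity for \<open>\<delta>\<close> at \<open>x\<close>, plus the same side of that identity at \<open>G x\<close>.\<close>

lemma special_nijenhuis:
  assumes nij: "nijenhuis_operator R A \<delta> F" and comm: "\<And>x. x \<in> carrier A \<Longrightarrow> F (G x) = G (F x)"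
    and x: "x \<in> carrier A"
  shows "(F \<otimes>\<otimes> F) (\<Delta> x) \<oplus>\<^bsub>T2\<^esub> \<Delta> (F (F x)) = (F \<otimes>\<otimes> id) (\<Delta> (F x)) \<oplus>\<^bsub>T2\<^esub> F_right (\<Delta> (F x))"
proof -
  interpret T2: module R T2 by (rule T2_module)
  let ?FF = "F \<otimes>\<otimes> F" and ?F1 = "F \<otimes>\<otimes> id"
  note lin = map2_linear[OF F F] map2_linear[OF F linear_id] F_right_linear
  note [simp] = x linear_closed[OF F] linear_closed[OF G] linear_closed[OF comult_linear]
    lin[THEN linear_closed]
  note nijenhuis = nijenhuis_operator.nijenhuis[OF nij]
  note map2_comp = tensor_map_comp[OF A_module A_module A_module A_module A_module A_module]
  have comm_FF: "?FF (F_right w) = F_right (?FF w)" and comm_F1: "?F1 (F_right w) = F_right (?F1 w)"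
    if "w \<in> carrier T2" for w
    using that by (simp_all add: map2_comp F linear_id)
  have "?FF (\<Delta> x) \<oplus>\<^bsub>T2\<^esub> \<Delta> (F (F x))
      = (F_right (?FF (\<delta> x)) \<oplus>\<^bsub>T2\<^esub> ?FF (\<delta> (G x))) \<oplus>\<^bsub>T2\<^esub> (F_right (\<delta> (F (F x))) \<oplus>\<^bsub>T2\<^esub> \<delta> (F (F (G x))))"
    by (simp add: special_comult_def linear_add[OF lin(1)] comm_FF comm)
  also have "\<dots> = F_right (?FF (\<delta> x) \<oplus>\<^bsub>T2\<^esub> \<delta> (F (F x))) \<oplus>\<^bsub>T2\<^esub> (?FF (\<delta> (G x)) \<oplus>\<^bsub>T2\<^esub> \<delta> (F (F (G x))))"
    by (simp add: linear_add[OF lin(3)] T2.a_ac)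
  also have "\<dots> = F_right (?F1 (\<delta> (F x)) \<oplus>\<^bsub>T2\<^esub> F_right (\<delta> (F x))) \<oplus>\<^bsub>T2\<^esub>
      (?F1 (\<delta> (F (G x))) \<oplus>\<^bsub>T2\<^esub> F_right (\<delta> (F (G x))))"
    by (simp only: nijenhuis[OF x] nijenhuis[OF linear_closed[OF G x]])
  also have "\<dots> = (F_right (?F1 (\<delta> (F x))) \<oplus>\<^bsub>T2\<^esub> ?F1 (\<delta> (F (G x)))) \<oplus>\<^bsub>T2\<^esub>
      (F_right (F_right (\<delta> (F x))) \<oplus>\<^bsub>T2\<^esub> F_right (\<delta> (F (G x))))"
    by (simp add: linear_add[OF lin(3)] T2.a_ac)
  also have "\<dots> = ?F1 (\<Delta> (F x)) \<oplus>\<^bsub>T2\<^esub> F_right (\<Delta> (F x))"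
    by (simp add: special_comult_def linear_add[OF lin(2)] linear_add[OF lin(3)] comm_F1 comm)
  finally show ?thesis .
qed

end

theorem proposition4p6:
  fixes R :: "('r, 'm) ring_scheme" and A :: "('r, 'a, 'n) module_scheme"
    and \<delta> :: "('r, 'a) comult" and F G :: "'a \<Rightarrow> 'a"
  assumes "cocommutative_coassociative_coalgebra R A \<delta>"
    and "F \<in> linear_maps R A A" and "G \<in> linear_maps R A A"
  shows "left_alia_coalgebra R A (special_comult R A \<delta> F G) \<and>
    (nijenhuis_coassociative_coalgebra R A \<delta> F \<and> (\<forall>x\<in>carrier A. F (G x) = G (F x)) \<longrightarrow>
     nijenhuis_special_left_alia_coalgebra R A (special_comult R A \<delta> F G) F)"
proof -
  interpret \<delta>: cocommutative_coassociative_coalgebra R A \<delta> by fact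
  interpret special_cube R A \<delta> F G
    by (intro special_cube.intro cocommutative_cube.intro tensor_cube.intro special_cube_axioms.intro
        \<delta>.module_axioms assms)
  let ?\<Delta> = "special_comult R A \<delta> F G"
  have alia: "left_alia_coalgebra R A ?\<Delta>" by (rule special_left_alia)
  moreover have "nijenhuis_special_left_alia_coalgebra R A ?\<Delta> F"
    if nij: "nijenhuis_coassociative_coalgebra R A \<delta> F"
      and comm: "\<forall>x\<in>carrier A. F (G x) = G (F x)"
  proof -
    have nij': "nijenhuis_operator R A \<delta> F"
      using nij by (simp add: nijenhuis_coassociative_coalgebra_def)
    have "special_left_alia_coalgebra R A ?\<Delta>"
      using alia assms
      by (auto simp: special_left_alia_coalgebra_def special_left_alia_coalgebra_axioms_def)
    moreover have "nijenhuis_operator R A ?\<Delta> F"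
      using left_alia_coalgebra.axioms(1)[OF alia] special_nijenhuis[OF nij'] comm assms(2)
      by (simp add: nijenhuis_operator_def nijenhuis_operator_axioms_def)
    ultimately show ?thesis
      using alia
      by (simp add: nijenhuis_special_left_alia_coalgebra_def nijenhuis_left_alia_coalgebra_def)
  qed
  ultimately show ?thesis by blast
qed

end
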